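(* For $\tau$ in the critical strip, i.e. for $|\operatorname{Im}(\tau)|<1/2$ ($\tau$ is not restricted to be real), $$\Xi(\tau)=4\pi^2\sum_{n=1}^{\infty}\int_1^{\infty}dt\,t^{1/4}\cos(\tau\ln\sqrt{t})\left(n^4t-\frac{3}{2\pi}n^2\right)e^{-n^2\pi t}$$ $$=4\int_1^{\infty}dt\,t^{1/4}\cos\left[\tfrac12\tau\ln t\right]\left[t\,\psi''(t)+\tfrac32\psi'(t)\right]$$ $$=\frac12-\left(\tau^2+\tfrac14\right)\sum_{n=1}^{\infty}\operatorname{Re}\,E_{\frac34+i\frac{\tau}{2}}(\pi n^2).$$ So $$\Xi(\tau)=\frac12-\left(\tau^2+\tfrac14\right)\int_1^{\infty}\frac{dt}{t^{3/4}}\cos\left(\tfrac{\tau}{2}\ln t\right)\psi(t).$$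
   Context: Riemann's function is $\xi(s)=(s-1)\pi^{-s/2}\Gamma(1+s/2)\zeta(s)$, where $\zeta$ is the Riemann zeta function; it satisfies $\xi(1-s)=\xi(s)$. $\Xi(\tau)=\xi(1/2+i\tau)$. $E_z(a)=\int_1^{\infty}t^{-z}e^{-at}\,dt$. $\psi(x)=\sum_{n=1}^{\infty}e^{-\pi n^2x}$, and primes denote derivatives of $\psi$.
   Formalization: For non-real τ the literal Re E makes the third equality false (e.g. τ = ib, 0<b<1/2), so Re is replaced by its analytic continuation in τ, (E_{3/4+iτ/2}(πn²) + E_{3/4−iτ/2}(πn²))/2; for real τ the literal Re formula is also stated. *)

theory Defs
  imports "HOL-Complex_Analysis.Complex_Analysis"
begin

text \<open>The analytic continuation of the Dirichlet series to \<open>\<complex> - {1}\<close>; it is unique there by the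
  identity theorem, and its value at the pole \<open>1\<close> is left unspecified.\<close>

definition zeta :: "complex \<Rightarrow> complex" where
  "zeta = (SOME f. f holomorphic_on (- {1}) \<and>
     (\<forall>s. 1 < Re s \<longrightarrow> (\<lambda>n. 1 / of_nat (Suc n) powr s) sums f s))"

text \<open>The formula has removable singularities at \<open>1, -2, -4, \<dots>\<close>, which are not filled in
  here; none of them lies in the open strip \<open>0 < Re s < 1\<close>.\<close>

definition riemann_xi :: "complex \<Rightarrow> complex" where
  "riemann_xi s = (s - 1) * of_real pi powr (- s / 2) * Gamma (1 + s / 2) * zeta s"

definition riemann_Xi :: "complex \<Rightarrow> complex" where
  "riemann_Xi \<tau> = riemann_xi (1 / 2 + \<i> * \<tau>)"

definition exp_integral :: "complex \<Rightarrow> complex \<Rightarrow> complex" where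
  "exp_integral z a = (LBINT t:{1..}. of_real t powr (- z) * exp (- a * of_real t))"

definition psi :: "real \<Rightarrow> real" where
  "psi x = (\<Sum>n. exp (- pi * (real (Suc n))\<^sup>2 * x))"

text \<open>The real part of \<open>F\<close> as a function of a real variable, continued analytically to a complex
  variable: if \<open>F\<close> is holomorphic on a set symmetric under conjugation, then so is
  \<open>continued_Re F\<close>. For \<open>F \<tau> = E\<^bsub>3/4 + i\<tau>/2\<^esub>(a)\<close> with real \<open>a > 0\<close> this is
  \<open>(E\<^bsub>3/4 + i\<tau>/2\<^esub>(a) + E\<^bsub>3/4 - i\<tau>/2\<^esub>(a)) / 2\<close>. The literal real part is not
  analytic in \<open>\<tau>\<close>.\<close>

definition continued_Re :: "(complex \<Rightarrow> complex) \<Rightarrow> complex \<Rightarrow> complex" where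
  "continued_Re F \<tau> = (F \<tau> + cnj (F (cnj \<tau>))) / 2"

lemma continued_Re_of_real: "continued_Re F (of_real x) = of_real (Re (F (of_real x)))"
  by (simp add: continued_Re_def complex_add_cnj)

end

theory Submission
  imports Defs "HOL-Real_Asymp.Real_Asymp"
begin

text \<open>
  Polya's proof of the theta inversion \<open>1 + 2\<psi>(x) = x\<^sup>-\<^sup>1\<^sup>/\<^sup>2 (1 + 2\<psi>(1/x))\<close>: average
  \<open>(2 cos \<theta>)\<^sup>2\<^sup>m\<close> over the multiples of \<open>\<pi>/l\<close>, expand by the binomial theorem, and let
  \<open>l \<rightarrow> \<infinity>\<close> with \<open>m/l\<^sup>2 \<rightarrow> x/\<pi>\<close>; both sides become theta series by dominated convergence.
  Riemann's splitting of the Mellin integral of \<open>\<psi>\<close> at \<open>1\<close> then continues \<open>\<zeta>\<close> to \<open>\<complex> - {1}\<close> and gives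
  the last formula for \<open>\<Xi>\<close>. Termwise integration yields the exponential integrals, and two integrations
  by parts, whose boundary terms are evaluated by \<open>4\<psi>'(1) + \<psi>(1) = -1/2\<close>, yield the first two formulas.
\<close>

subsection \<open>The Jacobi theta inversion\<close>

text \<open>The finite identity behind the inversion counts returns of a simple random walk:
  \<open>l\<close> times the probability that a walk of 2m steps on the cycle of odd length l ends
  where it began. Fourier modes of the cycle give the powers of cosines; summing over winding
  numbers gives the binomial coefficients. The limit is the heat kernel on a circle.

  What shapes the second half is that \<open>zeta\<close> is chosen by its properties alone: nothing
  is known about it until some continuation has been exhibited, so the integral formula comes before
  any statement about \<open>zeta\<close> inside the strip. The points s = 1/2 + i tau and 1 - s
  contribute the powers t^(-3/4 + i tau/2) and t^(-3/4 - i tau/2). Their mean is the cosine weight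
  for every complex tau, whereas it is a real part only for real tau; this is why the exponential
  integrals are combined by \<open>continued_Re\<close>. The constant 1/2 of the last formula,
  absent from the first two, must be produced exactly by the boundary terms at t = 1.\<close>

lemma sum_atMost_double_symmetric:
  fixes f :: "nat \<Rightarrow> 'a::comm_monoid_add"
  shows "(\<Sum>r\<le>2 * m. f r) = f m + (\<Sum>d\<in>{1..m}. f (m + d) + f (m - d))"
proof -
  have "{..2 * m} = {..<m} \<union> {m..2 * m}" by auto
  then have "(\<Sum>r\<le>2 * m. f r) = (\<Sum>r<m. f r) + sum f {m..2 * m}"
    by (simp only:, subst sum.union_disjoint) auto
  also have "sum f {m..2 * m} = f m + (\<Sum>r\<in>{m<..2 * m}. f r)"
    by (rule sum.head) simp
  finally have "(\<Sum>r\<le>2 * m. f r) = (\<Sum>r<m. f r) + (f m + (\<Sum>r\<in>{m<..2 * m}. f r))" .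
  moreover have "(\<Sum>r<m. f r) = (\<Sum>d\<in>{1..m}. f (m - d))"
    by (rule sum.reindex_bij_witness[where i = "\<lambda>d. m - d" and j = "\<lambda>r. m - r"]) auto
  moreover have "(\<Sum>r\<in>{m<..2 * m}. f r) = (\<Sum>d\<in>{1..m}. f (m + d))"
    by (rule sum.reindex_bij_witness[where i = "\<lambda>d. m + d" and j = "\<lambda>r. r - m"]) auto
  ultimately show ?thesis by (simp add: sum.distrib ac_simps)
qed

text \<open>Binomial expansion of \<open>(cis \<theta> + cis (- \<theta>)) ^ (2 * m)\<close>. The
  terms of index m + d and m - d have equal coefficients and opposite frequencies, so each pair is a
  cosine; the central term stays alone.\<close>

lemma cos_power_even:
  "(2 * cos \<theta>) ^ (2 * m) =
     real ((2 * m) choose m) + 2 * (\<Sum>d\<in>{1..m}. real ((2 * m) choose (m + d)) * cos (2 * real d * \<theta>))"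
proof -
  have "complex_of_real ((2 * cos \<theta>) ^ (2 * m)) = (cis \<theta> + cis (- \<theta>)) ^ (2 * m)"
    by (simp add: complex_eq_iff flip: of_real_mult)
  also have "\<dots> = (\<Sum>r\<le>2 * m. of_nat ((2 * m) choose r) * cis \<theta> ^ r * cis (- \<theta>) ^ (2 * m - r))"
    by (rule binomial_ring)
  also have "\<dots> = (\<Sum>r\<le>2 * m. of_nat ((2 * m) choose r) * cis ((2 * real r - 2 * real m) * \<theta>))"
  proof (rule sum.cong)
    fix r assume r: "r \<in> {..2 * m}"
    have "real r * \<theta> + real (2 * m - r) * (- \<theta>) = (2 * real r - 2 * real m) * \<theta>"
      using r by (simp add: algebra_simps)
    then show "of_nat ((2 * m) choose r) * cis \<theta> ^ r * cis (- \<theta>) ^ (2 * m - r) =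
          of_nat ((2 * m) choose r) * cis ((2 * real r - 2 * real m) * \<theta>)"
      by (simp only: Complex.DeMoivre mult.assoc cis_mult)
  qed simp
  also have "\<dots> = of_nat ((2 * m) choose m) +
      (\<Sum>d\<in>{1..m}. of_nat ((2 * m) choose (m + d)) * cis ((2 * real (m + d) - 2 * real m) * \<theta>) +
                 of_nat ((2 * m) choose (m - d)) * cis ((2 * real (m - d) - 2 * real m) * \<theta>))"
    by (subst sum_atMost_double_symmetric) simp
  also have "(\<Sum>d\<in>{1..m}. of_nat ((2 * m) choose (m + d)) * cis ((2 * real (m + d) - 2 * real m) * \<theta>) +
                 of_nat ((2 * m) choose (m - d)) * cis ((2 * real (m - d) - 2 * real m) * \<theta>)) =
      (\<Sum>d\<in>{1..m}. complex_of_real (2 * (real ((2 * m) choose (m + d)) * cos (2 * real d * \<theta>))))"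
  proof (rule sum.cong)
    fix d assume d: "d \<in> {1..m}"
    have "(2 * m) choose (m - d) = (2 * m) choose (m + d)"
      using d by (subst binomial_symmetric) auto
    then show "of_nat ((2 * m) choose (m + d)) * cis ((2 * real (m + d) - 2 * real m) * \<theta>) +
                 of_nat ((2 * m) choose (m - d)) * cis ((2 * real (m - d) - 2 * real m) * \<theta>) =
        complex_of_real (2 * (real ((2 * m) choose (m + d)) * cos (2 * real d * \<theta>)))"
      using d by (simp add: complex_eq_iff of_nat_diff algebra_simps)
  qed simp
  finally have "complex_of_real ((2 * cos \<theta>) ^ (2 * m)) =
     complex_of_real (real ((2 * m) choose m) + 2 * (\<Sum>d\<in>{1..m}. real ((2 * m) choose (m + d)) * cos (2 * real d * \<theta>)))"
    by (simp add: sum_distrib_left mult.assoc)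
  then show ?thesis using of_real_eq_iff by blast
qed

text \<open>Real part of a geometric sum over powers of an l-th root of unity. It filters out of
  \<open>cos_power_even\<close>, at angles pi j / l, the frequencies divisible by l.\<close>

lemma sum_cos_roots_of_unity:
  assumes "l > 0"
  shows "(\<Sum>j<l. cos (2 * pi * real j * real d / real l)) = (if l dvd d then real l else 0)"
proof -
  define w where "w = cis (2 * pi * real d / real l)"
  have eq: "(\<Sum>j<l. cos (2 * pi * real j * real d / real l)) = Re (\<Sum>j<l. w ^ j)"
    unfolding w_def Complex.DeMoivre by (simp add: mult_ac)
  have wl: "w ^ l = 1"
    using assms by (simp add: w_def Complex.DeMoivre cis_multiple_2pi)
  show ?thesis
  proof (cases "l dvd d")
    case True
    then obtain k where "d = l * k" by blast
    then have "2 * pi * real d / real l = 2 * pi * real k" using assms by simp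
    then have "w = 1" by (simp only: w_def cis_multiple_2pi Ints_of_nat)
    then show ?thesis using True eq by simp
  next
    case False
    have "w \<noteq> 1"
    proof
      assume "w = 1"
      then have "cos (2 * pi * real d / real l) = 1" by (simp add: w_def complex_eq_iff)
      then obtain n :: int where "2 * pi * real d / real l = of_int n * 2 * pi"
        by (auto simp: cos_one_2pi_int)
      then have "real d = of_int n * real l" using assms by (simp add: field_simps)
      then have "int d = n * int l" by (metis of_int_eq_iff of_int_mult of_int_of_nat_eq)
      then have "int l dvd int d" by simp
      then show False using False by simp
    qed
    then show ?thesis using False eq wl by (simp add: geometric_sum)
  qed
qed

text \<open>Double evaluation of the sum of (2 cos(pi j / l))^(2m) over j < l: folding j onto l - j
  gives the left side, and filtering the frequencies d = k l gives the right side. As l is odd, the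
  folding has no fixed point other than the separated j = 0.\<close>

lemma theta_inversion_finite:
  assumes "l = 2 * q + 1"
  shows "1 + 2 * (\<Sum>j\<in>{1..q}. cos (pi * real j / real l) ^ (2 * m)) =
    real l / 4 ^ m * (real ((2 * m) choose m) + 2 * (\<Sum>k\<in>{1..m}. real ((2 * m) choose (m + k * l))))"
proof -
  have l: "l > 0" using assms by simp
  define f where "f j = (2 * cos (pi * real j / real l)) ^ (2 * m)" for j
  have "(\<Sum>j<l. f j) = (\<Sum>r\<le>2 * q. f r)"
    by (rule sum.cong) (auto simp: assms)
  also have "\<dots> = f 0 + (\<Sum>j\<in>{1..2 * q}. f j)"
    by (simp add: sum.atMost_shift sum.atLeast1_atMost_eq lessThan_Suc_atMost)
  also have "{1..2 * q} = {1..q} \<union> {q+1..2 * q}" by auto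
  also have "sum f \<dots> = sum f {1..q} + sum f {q+1..2 * q}"
    by (rule sum.union_disjoint) auto
  also have "sum f {q+1..2 * q} = sum f {1..q}"
  \<comment> \<open>Reflecting j to l - j changes the sign of the cosine, which the even exponent
    removes.\<close>
  proof (rule sum.reindex_bij_witness[where i = "\<lambda>j. l - j" and j = "\<lambda>j. l - j"])
    fix j assume j: "j \<in> {q+1..2 * q}"
    have "pi * real (l - j) / real l = pi - pi * real j / real l"
      using j assms by (simp add: of_nat_diff field_simps)
    then show "f (l - j) = f j" by (simp add: f_def power_mult)
  qed (auto simp: assms)
  finally have 1: "(\<Sum>j<l. f j) = 4 ^ m * (1 + 2 * (\<Sum>j\<in>{1..q}. cos (pi * real j / real l) ^ (2 * m)))"
    by (simp add: f_def power_mult_distrib power_mult distrib_left flip: sum_distrib_left)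
  have "(\<Sum>j<l. f j) = (\<Sum>j<l. real ((2 * m) choose m) +
      2 * (\<Sum>d\<in>{1..m}. real ((2 * m) choose (m + d)) * cos (2 * pi * real j * real d / real l)))"
    unfolding f_def cos_power_even by (simp add: mult_ac)
  also have "\<dots> = real l * real ((2 * m) choose m) +
      2 * (\<Sum>d\<in>{1..m}. real ((2 * m) choose (m + d)) * (\<Sum>j<l. cos (2 * pi * real j * real d / real l)))"
    by (simp add: sum.distrib sum_distrib_left sum.swap[of _ "{..<l}"])
  also have "(\<Sum>d\<in>{1..m}. real ((2 * m) choose (m + d)) * (\<Sum>j<l. cos (2 * pi * real j * real d / real l))) =
      (\<Sum>d\<in>{d\<in>{1..m}. l dvd d}. real ((2 * m) choose (m + d)) * real l)"
    unfolding sum_cos_roots_of_unity[OF l] by (subst sum.inter_filter) (auto intro!: sum.cong)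
  also have "\<dots> = (\<Sum>k\<in>{k\<in>{1..m}. k * l \<le> m}. real ((2 * m) choose (m + k * l)) * real l)"
    by (rule sum.reindex_bij_witness[where i = "\<lambda>k. k * l" and j = "\<lambda>d. d div l"])
       (use l in \<open>auto simp: dvd_div_eq_0_iff Suc_le_eq dvd_imp_le div_greater_zero_iff intro: order.trans[OF div_le_dividend]\<close>)
  \<comment> \<open>Indices with k l > m only add vanishing binomial coefficients.\<close>
  also have "\<dots> = (\<Sum>k\<in>{1..m}. real ((2 * m) choose (m + k * l)) * real l)"
    by (rule sum.mono_neutral_left) (auto simp: binomial_eq_0)
  finally have "(\<Sum>j<l. f j) =
      real l * (real ((2 * m) choose m) + 2 * (\<Sum>k\<in>{1..m}. real ((2 * m) choose (m + k * l))))"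
    by (simp add: algebra_simps flip: sum_distrib_left)
  with 1 show ?thesis by (simp add: field_simps)
qed

section \<open>Gaussian bounds for ratios of binomial coefficients\<close>

text \<open>The inequality 1 + y \<le> exp y at y = x / (1 - x), inverted. It is the counterpart of
  1 - x \<le> exp(-x) in the lower bounds for binomial coefficients and for powers of the
  cosine.\<close>

lemma one_minus_ge_exp:
  fixes x :: real
  assumes "x < 1"
  shows "exp (- (x / (1 - x))) \<le> 1 - x"
proof -
  have "1 / (1 - x) \<le> exp (x / (1 - x))"
    using exp_ge_add_one_self[of "x / (1 - x)"] assms by (simp add: field_simps)
  then show ?thesis using assms by (simp add: exp_minus field_simps)
qed

text \<open>The quotient of neighbours is (m - r) / (m + r + 1), written as 1 minus a small quantity
  so that it can be compared with exponentials.\<close>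

lemma binomial_ratio_Suc:
  assumes "r < m"
  shows "real ((2 * m) choose (m + Suc r)) =
    real ((2 * m) choose (m + r)) * (1 - (2 * real r + 1) / (real m + real r + 1))"
proof -
  have "Suc (m + r) * ((2 * m) choose Suc (m + r)) = (2 * m - (m + r)) * ((2 * m) choose (m + r))"
    using binomial_absorb_comp[of "2 * m" "m + r"] binomial_absorption[of "m + r" "2 * m"]
    by (metis binomial_absorption binomial_absorb_comp)
  then have "real (Suc (m + r)) * real ((2 * m) choose Suc (m + r)) =
      (real m - real r) * real ((2 * m) choose (m + r))"
    using assms by (metis (no_types, lifting) add_diff_cancel_left diff_add_inverse less_imp_le mult_2 of_nat_diff of_nat_mult diff_diff_left)
  then show ?thesis by (simp add: field_simps)
qed

text \<open>Each factor 1 - x is at most exp(-x). The fixed bound \<open>R\<close> gives all factors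
  the common denominator m + R, so that the exponents are consecutive odd numbers over it and add up
  to r squared.\<close>

lemma binomial_ratio_upper:
  assumes "r \<le> m" "r \<le> R"
  shows "real ((2 * m) choose (m + r)) \<le> real ((2 * m) choose m) * exp (- ((real r)\<^sup>2 / (real m + real R)))"
  using assms
proof (induction r)
  case (Suc r)
  define x where "x = (2 * real r + 1) / (real m + real r + 1)"
  have x: "0 \<le> x" "x \<le> 1"
    using Suc.prems by (auto simp: x_def field_simps)
  have "1 - x \<le> exp (- x)" using exp_ge_add_one_self[of "-x"] by simp
  also have "x \<ge> (2 * real r + 1) / (real m + real R)"
    unfolding x_def using Suc.prems by (intro divide_left_mono) auto
  then have "exp (- x) \<le> exp (- ((2 * real r + 1) / (real m + real R)))" by simp
  finally have "real ((2 * m) choose (m + Suc r)) \<le>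
      (real ((2 * m) choose m) * exp (- ((real r)\<^sup>2 / (real m + real R))))
        * exp (- ((2 * real r + 1) / (real m + real R)))"
    using Suc x unfolding binomial_ratio_Suc[OF Suc_le_lessD[OF Suc.prems(1)]] x_def[symmetric]
    by (intro mult_mono) auto
  also have "\<dots> = real ((2 * m) choose m) * exp (- ((real (Suc r))\<^sup>2 / (real m + real R)))"
    by (simp add: mult.assoc power2_eq_square add_divide_distrib algebra_simps flip: exp_add)
  finally show ?case .
qed auto

text \<open>The same telescoping of odd numbers with \<open>one_minus_ge_exp\<close>: here x / (1 -
  x) is (2r + 1) / (m - r), and m - R serves as the common denominator.\<close>

lemma binomial_ratio_lower:
  assumes "r \<le> R" "R < m"
  shows "real ((2 * m) choose m) * exp (- ((real r)\<^sup>2 / (real m - real R))) \<le> real ((2 * m) choose (m + r))"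
  using assms
proof (induction r)
  case (Suc r)
  define x where "x = (2 * real r + 1) / (real m + real r + 1)"
  have x: "0 \<le> x" "x < 1" "1 - x = (real m - real r) / (real m + real r + 1)"
    using Suc.prems by (auto simp: x_def field_simps)
  have "x / (1 - x) = (2 * real r + 1) / (real m - real r)"
    using Suc.prems unfolding x(3) unfolding x_def by (subst divide_divide_eq_right) simp
  also have "\<dots> \<le> (2 * real r + 1) / (real m - real R)"
    using Suc.prems by (intro divide_left_mono) auto
  finally have "exp (- ((2 * real r + 1) / (real m - real R))) \<le> exp (- (x / (1 - x)))" by simp
  also have "\<dots> \<le> 1 - x" by (rule one_minus_ge_exp) fact
  finally have "(real ((2 * m) choose m) * exp (- ((real r)\<^sup>2 / (real m - real R))))
      * exp (- ((2 * real r + 1) / (real m - real R))) \<le> real ((2 * m) choose (m + r)) * (1 - x)"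
    using Suc by (intro mult_mono) auto
  also have "\<dots> = real ((2 * m) choose (m + Suc r))"
    using Suc.prems by (subst binomial_ratio_Suc) (auto simp: x_def)
  also have "(real ((2 * m) choose m) * exp (- ((real r)\<^sup>2 / (real m - real R))))
      * exp (- ((2 * real r + 1) / (real m - real R))) =
      real ((2 * m) choose m) * exp (- ((real (Suc r))\<^sup>2 / (real m - real R)))"
    by (simp add: mult.assoc power2_eq_square add_divide_distrib algebra_simps flip: exp_add)
  finally show ?case .
qed auto

section \<open>The central binomial coefficient and the Wallis product\<close>

lemma central_binomial_Suc:
  "real (Suc n) * real ((2 * Suc n) choose Suc n) = 2 * (2 * real n + 1) * real ((2 * n) choose n)"
proof -
  have 1: "Suc n * ((2 * Suc n) choose Suc n) = (2 * Suc n) * (Suc (2 * n) choose n)"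
    using Suc_times_binomial[of n "Suc (2 * n)"] by simp
  have "Suc n * (Suc (2 * n) choose n) = Suc n * (Suc (2 * n) choose Suc n)"
    by (subst binomial_symmetric) auto
  also have "\<dots> = Suc (2 * n) * ((2 * n) choose n)"
    by (rule Suc_times_binomial)
  finally have 2: "Suc n * (Suc (2 * n) choose n) = Suc (2 * n) * ((2 * n) choose n)" .
  have "Suc n * ((2 * Suc n) choose Suc n) = 2 * (Suc (2 * n) * ((2 * n) choose n))"
    using 1 2 by (simp only: mult.assoc)
  then have "real (Suc n * ((2 * Suc n) choose Suc n)) = real (2 * (Suc (2 * n) * ((2 * n) choose n)))"
    by (simp only:)
  then show ?thesis by (simp del: binomial_Suc_Suc add: algebra_simps)
qed

text \<open>Turns the limit pi / 2 of the product into the asymptotics of the central coefficient,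
  which is the origin of the factor 1 / sqrt x in the inversion.\<close>

lemma wallis_product_conv_central_binomial:
  "(\<Prod>k=1..n. (4 * real k ^ 2) / (4 * real k ^ 2 - 1)) =
     (4 ^ n / real ((2 * n) choose n))\<^sup>2 / (2 * real n + 1)"
proof (induction n)
  case (Suc n)
  have eq: "real ((2 * Suc n) choose Suc n) = 2 * (2 * real n + 1) * real ((2 * n) choose n) / real (Suc n)"
    using central_binomial_Suc[of n] by (simp add: field_simps del: binomial_Suc_Suc)
  have pos: "real ((2 * n) choose n) > 0" by simp
  have odd: "4 * (real (Suc n))\<^sup>2 - 1 = (2 * real n + 1) * (2 * real n + 3)"
    by (simp add: power2_eq_square algebra_simps)
  have alg: "(p / b)\<^sup>2 / u * (4 * s\<^sup>2 / (u * v)) = (4 * p / (2 * u * b / s))\<^sup>2 / v"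
    if "b > 0" "s > 0" "u > 0" "v > 0" for p b s u v :: real
    using that by (simp add: field_simps power2_eq_square)
  have "(\<Prod>k=1..Suc n. (4 * real k ^ 2) / (4 * real k ^ 2 - 1)) =
      (4 ^ n / real ((2 * n) choose n))\<^sup>2 / (2 * real n + 1) *
        (4 * (real (Suc n))\<^sup>2 / ((2 * real n + 1) * (2 * real n + 3)))"
    unfolding odd[symmetric] Suc.IH[symmetric] by simp
  also have "\<dots> = (4 ^ Suc n / real ((2 * Suc n) choose Suc n))\<^sup>2 / (2 * real n + 3)"
    unfolding eq by (subst alg) simp_all
  also have "2 * real n + 3 = 2 * real (Suc n) + 1" by simp
  finally show ?case .
qed simp

section \<open>Estimates for the dominating series\<close>

lemma summable_exp_minus_squares:
  assumes "c > 0"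
  shows "summable (\<lambda>n. exp (- (c * (real (Suc n))\<^sup>2)))"
proof (rule summable_comparison_test')
  show "summable (\<lambda>n. exp (- c) ^ n)" using assms by (intro summable_geometric) simp
  show "norm (exp (- (c * (real (Suc n))\<^sup>2))) \<le> exp (- c) ^ n" for n
  proof -
    have "real n \<le> (real (Suc n))\<^sup>2" by (simp add: power2_eq_square algebra_simps)
    then show ?thesis using assms by (simp add: exp_of_nat_mult [symmetric] del: of_nat_Suc)
  qed
qed

text \<open>A weak form of Jordan's inequality; any positive constant would serve the domination. Up
  to pi/3 the cosine is at least 1/2, so sin y \<ge> y/2; beyond it monotonicity gives sin x \<ge>
  pi/6 \<ge> x/3.\<close>

lemma sin_ge_third:
  assumes "0 \<le> x" "x \<le> pi / 2"
  shows "x / 3 \<le> sin x"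
proof -
  have small: "y / 2 \<le> sin y" if "0 \<le> y" "y \<le> pi / 3" for y
  proof -
    have "sin 0 - 0 / 2 \<le> sin y - y / 2"
    proof (rule DERIV_nonneg_imp_nondecreasing[OF that(1), where f = "\<lambda>y. sin y - y / 2"], intro exI conjI)
      fix z assume z: "0 \<le> z" "z \<le> y"
      show "((\<lambda>y. sin y - y / 2) has_real_derivative cos z - 1 / 2) (at z)"
        by (auto intro!: derivative_eq_intros)
      have "cos (pi / 3) \<le> cos z" using z that by (intro cos_monotone_0_pi_le) auto
      then show "0 \<le> cos z - 1 / 2" by (simp add: cos_60)
    qed
    then show ?thesis by simp
  qed
  show ?thesis
  proof (cases "x \<le> pi / 3")
    case True
    then show ?thesis using small[of x] assms by simp
  next
    case False
    have "sin (pi / 3) \<le> sin x"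
      using False assms by (intro sin_monotone_2pi_le) auto
    then show ?thesis using small[of "pi / 3"] assms by simp
  qed
qed

text \<open>With y = sin^2 x this is exp(-y/(1-y)) \<le> 1 - y \<le> exp(-y) raised to the power m,
  where y/(1-y) = tan^2 x. Since sin x and tan x are both asymptotic to x, the cosine power is
  squeezed onto exp(-m x^2).\<close>

lemma cos_power_even_bounds:
  assumes "cos x \<noteq> 0"
  shows "cos x ^ (2 * m) \<le> exp (- (real m * (sin x)\<^sup>2))"
    and "exp (- (real m * (tan x)\<^sup>2)) \<le> cos x ^ (2 * m)"
proof -
  have "(cos x)\<^sup>2 \<le> exp (- (sin x)\<^sup>2)"
    using exp_ge_add_one_self[of "- (sin x)\<^sup>2"] by (simp add: cos_squared_eq)
  then have "((cos x)\<^sup>2) ^ m \<le> exp (- (sin x)\<^sup>2) ^ m" by (intro power_mono) auto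
  then show "cos x ^ (2 * m) \<le> exp (- (real m * (sin x)\<^sup>2))"
    by (simp add: power_mult flip: exp_of_nat_mult)
  have "exp (- ((sin x)\<^sup>2 / (1 - (sin x)\<^sup>2))) \<le> 1 - (sin x)\<^sup>2"
    using assms by (intro one_minus_ge_exp) (simp add: sin_squared_eq)
  then have "exp (- (tan x)\<^sup>2) \<le> (cos x)\<^sup>2"
    by (simp add: cos_squared_eq[symmetric] tan_def power_divide)
  then have "exp (- (tan x)\<^sup>2) ^ m \<le> ((cos x)\<^sup>2) ^ m" by (intro power_mono) auto
  then show "exp (- (real m * (tan x)\<^sup>2)) \<le> cos x ^ (2 * m)"
    by (simp add: power_mult flip: exp_of_nat_mult)
qed

section \<open>Passage to the limit in the finite identity\<close>

theorem theta_inversion: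
  assumes "x > 0"
  shows "1 + 2 * psi x = (1 + 2 * psi (1 / x)) / sqrt x"
proof -
  \<comment> \<open>With m close to a l^2, the exponent m (pi j / l)^2 tends to pi j^2 x while (k
    l)^2 / m tends to k^2 / a = pi k^2 / x.\<close>
  define a where "a = x / pi"
  define l where "l q = 2 * q + 1" for q :: nat
  define m where "m q = nat \<lfloor>a * (real (l q))\<^sup>2\<rfloor>" for q
  have a: "a > 0" using assms by (simp add: a_def)
  have lpos: "real (l q) > 0" for q by (simp add: l_def)
  have m_le: "real (m q) \<le> a * (real (l q))\<^sup>2" for q
    unfolding m_def using a by (simp add: of_nat_nat)
  have m_ge: "real (m q) \<ge> a * (real (l q))\<^sup>2 - 1" for q
    unfolding m_def using a by linarith
  have inv_l: "(\<lambda>q. 1 / real (l q)) \<longlonglongrightarrow> 0"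
    unfolding l_def by real_asymp
  have m_lim: "(\<lambda>q. real (m q) / (real (l q))\<^sup>2) \<longlonglongrightarrow> a"
  proof (rule tendsto_sandwich)
    show "(\<lambda>q. a - (1 / real (l q))\<^sup>2) \<longlonglongrightarrow> a"
      using tendsto_diff[OF tendsto_const tendsto_power[OF inv_l, of 2], of a] by simp
    show "\<forall>\<^sub>F q in sequentially. a - (1 / real (l q))\<^sup>2 \<le> real (m q) / (real (l q))\<^sup>2"
    proof (intro always_eventually allI)
      fix q
      have "a - (1 / real (l q))\<^sup>2 = (a * (real (l q))\<^sup>2 - 1) / (real (l q))\<^sup>2"
        using lpos[of q] by (simp add: power_divide diff_divide_distrib)
      also have "\<dots> \<le> real (m q) / (real (l q))\<^sup>2"
        using m_ge[of q] by (intro divide_right_mono) auto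
      finally show "a - (1 / real (l q))\<^sup>2 \<le> real (m q) / (real (l q))\<^sup>2" .
    qed
    show "\<forall>\<^sub>F q in sequentially. real (m q) / (real (l q))\<^sup>2 \<le> a"
      using m_le lpos by (intro always_eventually) (simp add: field_simps)
  qed simp_all
  have m_top: "filterlim m at_top sequentially"
  proof -
    have "filterlim (\<lambda>q. a * (real (l q))\<^sup>2 - 1) at_top sequentially"
      unfolding l_def using a by real_asymp
    then have "filterlim (\<lambda>q. real (m q)) at_top sequentially"
      by (rule filterlim_at_top_mono) (use m_ge in simp)
    then show ?thesis by (simp add: filterlim_sequentially_iff_filterlim_real)
  qed

  define C where "C q = real ((2 * m q) choose m q)" for q
  have Cpos: "C q > 0" for q by (simp add: C_def)
  \<comment> \<open>By Wallis the square of this expression tends to the reciprocal of 2a * pi/2,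
    which is x.\<close>
  have const: "(\<lambda>q. real (l q) / 4 ^ m q * C q) \<longlonglongrightarrow> 1 / sqrt x"
  proof -
    define W where "W n = (\<Prod>k=1..n. (4 * real k ^ 2) / (4 * real k ^ 2 - 1))" for n
    have "(\<lambda>q. W (m q)) \<longlonglongrightarrow> pi / 2"
      using filterlim_compose[OF wallis m_top] by (simp add: W_def)
    then have "(\<lambda>q. sqrt (1 / ((2 * (real (m q) / (real (l q))\<^sup>2) + (1 / real (l q))\<^sup>2) * W (m q)))) \<longlonglongrightarrow>
        sqrt (1 / ((2 * a + 0\<^sup>2) * (pi / 2)))"
      using a by (intro tendsto_intros m_lim inv_l) auto
    also have "sqrt (1 / ((2 * a + 0\<^sup>2) * (pi / 2))) = 1 / sqrt x"
      using assms by (simp add: a_def real_sqrt_divide)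
    also have "(\<lambda>q. sqrt (1 / ((2 * (real (m q) / (real (l q))\<^sup>2) + (1 / real (l q))\<^sup>2) * W (m q)))) =
        (\<lambda>q. real (l q) / 4 ^ m q * C q)"
    proof
      fix q
      have alg: "1 / ((2 * (u / L\<^sup>2) + (1 / L)\<^sup>2) * ((P / c)\<^sup>2 / (2 * u + 1))) = (L / P * c)\<^sup>2"
        if "L > 0" "c > 0" "u \<ge> 0" for L u P c :: real
      proof -
        have "2 * (u / L\<^sup>2) + (1 / L)\<^sup>2 = (2 * u + 1) / L\<^sup>2"
          by (simp add: power_divide add_divide_distrib)
        then show ?thesis using that by (simp add: power_divide power_mult_distrib)
      qed
      have "1 / ((2 * (real (m q) / (real (l q))\<^sup>2) + (1 / real (l q))\<^sup>2) * W (m q)) =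
          (real (l q) / 4 ^ m q * C q)\<^sup>2"
        unfolding W_def wallis_product_conv_central_binomial C_def[symmetric]
        using lpos[of q] Cpos[of q]
        by (intro alg) auto
      then show "sqrt (1 / ((2 * (real (m q) / (real (l q))\<^sup>2) + (1 / real (l q))\<^sup>2) * W (m q))) =
          real (l q) / 4 ^ m q * C q"
        using Cpos[of q] by (simp add: real_sqrt_unique)
    qed
    finally show ?thesis .
  qed

  \<comment> \<open>Extension by 0 makes the finite sums into series over a fixed index set, as
    Tannery's theorem requires. The shift \<open>Suc j\<close> matches the indexing of
    \<open>psi\<close>.\<close>
  define A where "A j q = (if j < q then cos (pi * real (Suc j) / real (l q)) ^ (2 * m q) else 0)" for j q :: nat
  have angle: "0 < pi * real (Suc j) / real (l q)" "pi * real (Suc j) / real (l q) < pi / 2" if "j < q" for j q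
  proof -
    show "0 < pi * real (Suc j) / real (l q)"
      using lpos[of q] by (intro divide_pos_pos mult_pos_pos) auto
    have "pi * (2 * real (Suc j)) < pi * real (l q)"
      using that by (intro mult_strict_left_mono) (auto simp: l_def)
    then show "pi * real (Suc j) / real (l q) < pi / 2"
      using lpos[of q] by (simp add: pos_divide_less_eq)
  qed
  have A_lim: "(\<lambda>q. A j q) \<longlonglongrightarrow> exp (- (pi * (real (Suc j))\<^sup>2 * x))" for j
  proof -
    define h where "h q = pi * real (Suc j) / real (l q)" for q
    have h0: "h \<longlonglongrightarrow> 0"
      using tendsto_mult[OF tendsto_const inv_l, of "pi * real (Suc j)"] by (simp add: h_def [abs_def])
    have hpos: "h q \<noteq> 0" for q using lpos[of q] by (simp add: h_def)
    have sq: "real (m q) * (h q)\<^sup>2 = (pi * real (Suc j))\<^sup>2 * (real (m q) / (real (l q))\<^sup>2)" for q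
      by (simp add: h_def power_divide)
    \<comment> \<open>One limit for both sides of the squeeze: \<open>g\<close> is tan h / h below
      and sin h / h above.\<close>
    have lim: "(\<lambda>q. exp (- (real (m q) * (h q)\<^sup>2) * (g q)\<^sup>2)) \<longlonglongrightarrow> exp (- (pi * (real (Suc j))\<^sup>2 * x))"
      if "g \<longlonglongrightarrow> 1" for g
    proof -
      have "(\<lambda>q. exp (- ((pi * real (Suc j))\<^sup>2 * (real (m q) / (real (l q))\<^sup>2)) * (g q)\<^sup>2)) \<longlonglongrightarrow>
          exp (- ((pi * real (Suc j))\<^sup>2 * a) * 1\<^sup>2)"
        by (intro tendsto_intros m_lim that)
      also have "- ((pi * real (Suc j))\<^sup>2 * a) * 1\<^sup>2 = - (pi * (real (Suc j))\<^sup>2 * x)"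
        by (simp add: a_def power2_eq_square)
      finally show ?thesis by (simp only: sq)
    qed
    have h_at: "filterlim h (at 0) sequentially"
      using h0 hpos by (simp add: filterlim_at)
    have "((\<lambda>z. sin z / z) \<longlongrightarrow> 1) (at (0::real))" by real_asymp
    from filterlim_compose[OF this h_at] have *: "(\<lambda>q. sin (h q) / h q) \<longlonglongrightarrow> 1" .
    have "((\<lambda>z. tan z / z) \<longlongrightarrow> 1) (at (0::real))" by real_asymp
    from filterlim_compose[OF this h_at] have **: "(\<lambda>q. tan (h q) / h q) \<longlonglongrightarrow> 1" .
    have cosh: "cos (h q) \<noteq> 0" if "j < q" for q
      using angle[OF that] cos_gt_zero[of "h q"] by (simp add: h_def)
    show ?thesis
    proof (rule tendsto_sandwich[OF _ _ lim[OF **] lim[OF *]])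
      show "\<forall>\<^sub>F q in sequentially. exp (- (real (m q) * (h q)\<^sup>2) * (tan (h q) / h q)\<^sup>2) \<le> A j q"
        using eventually_gt_at_top[of j]
      proof eventually_elim
        case (elim q)
        then show ?case using cos_power_even_bounds(2)[OF cosh[OF elim], of "m q"] hpos[of q]
          by (simp add: A_def power_divide) (simp add: h_def)
      qed
      show "\<forall>\<^sub>F q in sequentially. A j q \<le> exp (- (real (m q) * (h q)\<^sup>2) * (sin (h q) / h q)\<^sup>2)"
        using eventually_gt_at_top[of j]
      proof eventually_elim
        case (elim q)
        then show ?case using cos_power_even_bounds(1)[OF cosh[OF elim], of "m q"] hpos[of q]
          by (simp add: A_def power_divide) (simp add: h_def)
      qed
    qed
  qed
  \<comment> \<open>18 = 2 * 9: the 2 comes from m / l^2 > a / 2, valid eventually, and the 9 from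
    squaring the constant of \<open>sin_ge_third\<close>.\<close>
  define c where "c = a * pi\<^sup>2 / 18"
  have A_bound: "\<forall>\<^sub>F q in sequentially. \<forall>j. norm (A j q) \<le> exp (- (c * (real (Suc j))\<^sup>2))"
  proof -
    have "\<forall>\<^sub>F q in sequentially. a / 2 < real (m q) / (real (l q))\<^sup>2"
      using a by (intro order_tendstoD[OF m_lim]) simp
    then show ?thesis
    proof (eventually_elim, intro allI)
      case (elim q)
      fix j
      show "norm (A j q) \<le> exp (- (c * (real (Suc j))\<^sup>2))"
      proof (cases "j < q")
        case True
        define h where "h = pi * real (Suc j) / real (l q)"
        have h: "0 < h" "h < pi / 2" using angle[OF True] by (simp_all add: h_def)
        have "norm (A j q) = cos h ^ (2 * m q)"
          using True by (simp add: A_def h_def power_mult)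
        also have "\<dots> \<le> exp (- (real (m q) * (sin h)\<^sup>2))"
          using h cos_gt_zero[of h] by (intro cos_power_even_bounds) simp
        also have "\<dots> \<le> exp (- (c * (real (Suc j))\<^sup>2))"
        proof -
          have "(h / 3)\<^sup>2 \<le> (sin h)\<^sup>2" using sin_ge_third[of h] h by (intro power_mono) auto
          then have "real (m q) * (h / 3)\<^sup>2 \<le> real (m q) * (sin h)\<^sup>2" by (intro mult_left_mono) auto
          moreover have "real (m q) * (h / 3)\<^sup>2 = (real (m q) / (real (l q))\<^sup>2) * ((pi * real (Suc j))\<^sup>2 / 9)"
            by (simp add: h_def power_divide)
          moreover have "a / 2 * ((pi * real (Suc j))\<^sup>2 / 9) \<le> (real (m q) / (real (l q))\<^sup>2) * ((pi * real (Suc j))\<^sup>2 / 9)"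
            using elim by (intro mult_right_mono) auto
          moreover have "c * (real (Suc j))\<^sup>2 = a / 2 * ((pi * real (Suc j))\<^sup>2 / 9)"
            by (simp add: c_def power_mult_distrib)
          ultimately have "c * (real (Suc j))\<^sup>2 \<le> real (m q) * (sin h)\<^sup>2" by linarith
          then show ?thesis by simp
        qed
        finally show ?thesis .
      qed (simp add: A_def)
    qed
  qed
  have "(\<lambda>q. \<Sum>j. A j q) \<longlonglongrightarrow> (\<Sum>j. exp (- (pi * (real (Suc j))\<^sup>2 * x)))"
  proof -
    from A_bound obtain N where "\<And>q j. q \<ge> N \<Longrightarrow> norm (A j q) \<le> exp (- (c * (real (Suc j))\<^sup>2))"
      unfolding eventually_sequentially by blast
    then have "\<forall>\<^sub>F (j, q) in at_top \<times>\<^sub>F sequentially. norm (A j q) \<le> exp (- (c * (real (Suc j))\<^sup>2))"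
      by (auto simp: eventually_prod_sequentially)
    from tannerys_theorem[OF A_lim this] show ?thesis
      using summable_exp_minus_squares[of c] a by (simp add: c_def)
  qed
  moreover have "(\<Sum>j. A j q) = (\<Sum>j\<in>{1..q}. cos (pi * real j / real (l q)) ^ (2 * m q))" for q
  proof -
    have "(\<Sum>j. A j q) = (\<Sum>j<q. A j q)"
      by (rule suminf_finite) (auto simp: A_def)
    also have "\<dots> = (\<Sum>j<q. cos (pi * real (Suc j) / real (l q)) ^ (2 * m q))"
      by (intro sum.cong) (auto simp: A_def)
    finally show ?thesis by (simp only: One_nat_def sum.atLeast1_atMost_eq)
  qed
  ultimately have left: "(\<lambda>q. \<Sum>j\<in>{1..q}. cos (pi * real j / real (l q)) ^ (2 * m q)) \<longlonglongrightarrow> psi x"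
    by (simp add: psi_def)

  \<comment> \<open>No cut-off is written here: the binomial coefficient vanishes once
    \<open>Suc k * l q\<close> exceeds \<open>m q\<close>.\<close>
  define B where "B k q = real ((2 * m q) choose (m q + Suc k * l q)) / C q" for k q
  have B_upper: "B k q \<le> exp (- ((real (Suc k * l q))\<^sup>2 / (real (m q) + real (Suc k * l q))))" for k q
  proof (cases "Suc k * l q \<le> m q")
    case True
    then show ?thesis using binomial_ratio_upper[OF True order.refl] Cpos[of q]
      by (simp add: B_def C_def field_simps del: of_nat_mult of_nat_Suc mult_Suc)
  next
    case False
    then show ?thesis by (simp add: B_def binomial_eq_0 del: mult_Suc)
  qed
  \<comment> \<open>For a nonzero term the denominator in \<open>B_upper\<close> is at most 2m,
    hence at most 2 a l^2, and l cancels. The bound holds for every q.\<close>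
  have B_bound: "norm (B k q) \<le> exp (- (1 / (2 * a) * (real (Suc k))\<^sup>2))" for k q
  proof (cases "Suc k * l q \<le> m q")
    case True
    have "real (l q) \<le> real (m q)"
      using True by (metis le_trans mult_Suc le_add1 of_nat_le_iff)
    then have mpos: "real (m q) > 0" using lpos[of q] by linarith
    have "norm (B k q) = B k q" using Cpos[of q] by (simp add: B_def)
    also note B_upper
    also have "exp (- ((real (Suc k * l q))\<^sup>2 / (real (m q) + real (Suc k * l q)))) \<le>
        exp (- (1 / (2 * a) * (real (Suc k))\<^sup>2))"
    proof -
      have "1 / (2 * a) * (real (Suc k))\<^sup>2 = (real (Suc k * l q))\<^sup>2 / (2 * (a * (real (l q))\<^sup>2))"
        using lpos[of q] by (simp only: of_nat_mult power_mult_distrib) simp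
      also have "\<dots> \<le> (real (Suc k * l q))\<^sup>2 / (2 * real (m q))"
        using m_le[of q] a mpos lpos[of q] by (intro divide_left_mono mult_left_mono mult_pos_pos) auto
      also have "\<dots> \<le> (real (Suc k * l q))\<^sup>2 / (real (m q) + real (Suc k * l q))"
        using True mpos by (intro divide_left_mono) (auto simp del: of_nat_mult of_nat_Suc mult_Suc)
      finally show ?thesis by simp
    qed
    finally show ?thesis .
  next
    case False
    then show ?thesis by (simp add: B_def binomial_eq_0 del: mult_Suc)
  qed
  have B_lim: "(\<lambda>q. B k q) \<longlonglongrightarrow> exp (- (pi * (real (Suc k))\<^sup>2 * (1 / x)))" for k
  proof -
    \<comment> \<open>The sign e = 1 or e = -1 treats the upper and lower Gaussian bounds together.
      After division by l^2 the correction is of order 1 / l and disappears in the limit.\<close>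
    have eq: "exp (- ((real (Suc k * l q))\<^sup>2 / (real (m q) + e * real (Suc k * l q)))) =
        exp (- ((real (Suc k))\<^sup>2 / (real (m q) / (real (l q))\<^sup>2 + e * (real (Suc k) * (1 / real (l q))))))" for q e
    proof -
      have "real (m q) + e * real (Suc k * l q) =
        (real (l q))\<^sup>2 * (real (m q) / (real (l q))\<^sup>2 + e * (real (Suc k) * (1 / real (l q))))"
        using lpos[of q] by (simp add: field_simps power2_eq_square)
      then show ?thesis using lpos[of q] by (simp add: power_mult_distrib del: of_nat_Suc mult_Suc)
    qed
    have lim: "(\<lambda>q. exp (- ((real (Suc k * l q))\<^sup>2 / (real (m q) + e * real (Suc k * l q))))) \<longlonglongrightarrow>
        exp (- (pi * (real (Suc k))\<^sup>2 * (1 / x)))" for e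
    proof -
      have "(\<lambda>q. exp (- ((real (Suc k))\<^sup>2 / (real (m q) / (real (l q))\<^sup>2 + e * (real (Suc k) * (1 / real (l q)))))))
          \<longlonglongrightarrow> exp (- ((real (Suc k))\<^sup>2 / (a + e * (real (Suc k) * 0))))"
        using a by (intro tendsto_intros m_lim inv_l) auto
      then show ?thesis unfolding eq using assms by (simp add: a_def mult.commute)
    qed
    show ?thesis
    proof (rule tendsto_sandwich[OF _ _ lim[of "-1"] lim[of 1]])
      show "\<forall>\<^sub>F q in sequentially. B k q \<le> exp (- ((real (Suc k * l q))\<^sup>2 / (real (m q) + 1 * real (Suc k * l q))))"
        using B_upper by simp
      have "(\<lambda>q. real (m q) / (real (l q))\<^sup>2 - real (Suc k) * (1 / real (l q))) \<longlonglongrightarrow> a - real (Suc k) * 0"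
        by (intro tendsto_intros m_lim inv_l)
      then have "\<forall>\<^sub>F q in sequentially. 0 < real (m q) / (real (l q))\<^sup>2 - real (Suc k) * (1 / real (l q))"
        using a by (intro order_tendstoD(1)) simp_all
      then show "\<forall>\<^sub>F q in sequentially. exp (- ((real (Suc k * l q))\<^sup>2 / (real (m q) + - 1 * real (Suc k * l q)))) \<le> B k q"
      proof eventually_elim
        case (elim q)
        then have "real (Suc k * l q) < real (m q)"
          using lpos[of q] by (simp add: field_simps power2_eq_square)
        then have "Suc k * l q < m q" by (simp only: of_nat_less_iff)
        from binomial_ratio_lower[OF order.refl this] show ?case using Cpos[of q]
          by (simp add: B_def C_def field_simps del: of_nat_mult of_nat_Suc mult_Suc)
      qed
    qed
  qed
  have "(\<lambda>q. \<Sum>k. B k q) \<longlonglongrightarrow> psi (1 / x)"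
  proof -
    have "\<forall>\<^sub>F (k, q) in at_top \<times>\<^sub>F sequentially. norm (B k q) \<le> exp (- (1 / (2 * a) * (real (Suc k))\<^sup>2))"
      using B_bound by (simp add: case_prod_unfold)
    from tannerys_theorem[OF B_lim this] show ?thesis
      using summable_exp_minus_squares[of "1 / (2 * a)"] a by (simp add: psi_def)
  qed
  then have right: "(\<lambda>q. real (l q) / 4 ^ m q * C q * (1 + 2 * (\<Sum>k. B k q))) \<longlonglongrightarrow> 1 / sqrt x * (1 + 2 * psi (1 / x))"
    by (intro tendsto_intros const)
  have "1 + 2 * (\<Sum>j\<in>{1..q}. cos (pi * real j / real (l q)) ^ (2 * m q)) =
      real (l q) / 4 ^ m q * C q * (1 + 2 * (\<Sum>k. B k q))" for q
  proof -
    have "(\<Sum>k. B k q) = (\<Sum>k<m q. B k q)"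
    proof (rule suminf_finite)
      fix k assume "k \<notin> {..<m q}"
      then have "m q < Suc k * 1" by simp
      also have "\<dots> \<le> Suc k * l q" by (intro mult_le_mono) (auto simp: l_def)
      finally show "B k q = 0" by (simp add: B_def binomial_eq_0 del: mult_Suc)
    qed simp
    also have "\<dots> = (\<Sum>k\<in>{1..m q}. real ((2 * m q) choose (m q + k * l q))) / C q"
      by (simp only: B_def sum_divide_distrib One_nat_def sum.atLeast1_atMost_eq)
    finally show ?thesis
      unfolding theta_inversion_finite[OF l_def] C_def[symmetric]
      using Cpos[of q] by (simp add: field_simps)
  qed
  then have "(\<lambda>q. real (l q) / 4 ^ m q * C q * (1 + 2 * (\<Sum>k. B k q))) \<longlonglongrightarrow> 1 + 2 * psi x"
    using tendsto_add[OF tendsto_const tendsto_mult[OF tendsto_const left], of 1 2] by simp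
  from LIMSEQ_unique[OF this right] show ?thesis by simp
qed

subsection \<open>Derivatives of psi and termwise integration\<close>

definition freq :: "nat \<Rightarrow> real" where "freq n = pi * (real (Suc n))\<^sup>2"

definition psi_deriv :: "nat \<Rightarrow> real \<Rightarrow> real" where
  "psi_deriv k x = (\<Sum>n. (- freq n) ^ k * exp (- freq n * x))"

lemma psi_eq_psi_deriv: "psi = psi_deriv 0"
  by (simp add: fun_eq_iff psi_def psi_deriv_def freq_def)

lemma freq_ge_1: "freq n \<ge> 1"
proof -
  have "1 * 1 \<le> pi * (real (Suc n))\<^sup>2"
    using pi_gt3 by (intro mult_mono) auto
  then show ?thesis by (simp add: freq_def)
qed

lemma freq_pos: "freq n > 0"
  using freq_ge_1[of n] by linarith

lemma power_le_fact_exp: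
  fixes x :: real
  assumes "x \<ge> 0"
  shows "x ^ k \<le> fact k * exp x"
proof -
  have "(\<Sum>i\<in>{k}. inverse (fact i) * x ^ i) \<le> (\<Sum>i. inverse (fact i) * x ^ i)"
    using assms summable_exp[of x] by (intro sum_le_suminf) auto
  then have "x ^ k / fact k \<le> exp x"
    by (simp add: exp_def divide_inverse mult.commute)
  then show ?thesis by (simp add: field_simps)
qed

text \<open>Half of the exponent absorbs the power of \<open>freq n\<close> through
  \<open>power_le_fact_exp\<close>; the other half is a summable Gaussian.\<close>

lemma summable_freq_power_exp:
  assumes "c > 0"
  shows "summable (\<lambda>n. freq n ^ k * exp (- (c * freq n)))"
proof (rule summable_comparison_test')
  show "summable (\<lambda>n. (2 / c) ^ k * fact k * exp (- (c * pi / 2 * (real (Suc n))\<^sup>2)))"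
    using assms by (intro summable_mult summable_exp_minus_squares) simp
  show "norm (freq n ^ k * exp (- (c * freq n))) \<le> (2 / c) ^ k * fact k * exp (- (c * pi / 2 * (real (Suc n))\<^sup>2))" for n
  proof -
    have "freq n ^ k = (2 / c) ^ k * (c * freq n / 2) ^ k"
      using assms by (simp add: power_mult_distrib[symmetric])
    also have "\<dots> \<le> (2 / c) ^ k * (fact k * exp (c * freq n / 2))"
      using assms freq_pos[of n] by (intro mult_left_mono power_le_fact_exp) auto
    finally have "freq n ^ k * exp (- (c * freq n)) \<le>
        (2 / c) ^ k * (fact k * exp (c * freq n / 2)) * exp (- (c * freq n))"
      by (intro mult_right_mono) auto
    also have "\<dots> = (2 / c) ^ k * fact k * exp (- (c * pi / 2 * (real (Suc n))\<^sup>2))"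
      by (simp add: mult.assoc flip: exp_add) (simp add: freq_def)
    finally show ?thesis using freq_pos[of n] by simp
  qed
qed

lemma abs_freq_power_exp_le:
  assumes "c \<le> x"
  shows "\<bar>(- freq n) ^ k * exp (- freq n * x)\<bar> \<le> freq n ^ k * exp (- (c * freq n))"
  using assms freq_pos[of n] by (simp add: abs_mult power_abs mult.commute)

lemma summable_psi_deriv:
  assumes "x > 0"
  shows "summable (\<lambda>n. \<bar>(- freq n) ^ k * exp (- freq n * x)\<bar>)"
  using abs_freq_power_exp_le[OF order.refl, of _ k x]
  by (intro summable_comparison_test'[OF summable_freq_power_exp[OF assms, of k]]) simp

lemma has_real_derivative_psi_deriv:
  assumes "x > 0"
  shows "(psi_deriv k has_real_derivative psi_deriv (Suc k) x) (at x)"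
proof -
  have "((\<lambda>x. \<Sum>n. (- freq n) ^ k * exp (- freq n * x)) has_real_derivative
      (\<Sum>n. (- freq n) ^ Suc k * exp (- freq n * x))) (at x)"
  \<comment> \<open>A neighbourhood of x that stays away from 0, where the series of derivatives has
    a majorant independent of the point.\<close>
  proof (rule has_field_derivative_series'(2)[where S = "{x / 2<..}" and ?x0.0 = x])
    show "uniformly_convergent_on {x / 2<..} (\<lambda>n x. \<Sum>i<n. (- freq i) ^ Suc k * exp (- freq i * x))"
    proof (rule Weierstrass_m_test')
      show "summable (\<lambda>n. freq n ^ Suc k * exp (- (x / 2 * freq n)))"
        using assms by (intro summable_freq_power_exp) simp
      show "norm ((- freq n) ^ Suc k * exp (- freq n * y)) \<le> freq n ^ Suc k * exp (- (x / 2 * freq n))"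
        if "y \<in> {x / 2<..}" for n y
        using that abs_freq_power_exp_le[of "x / 2" y n "Suc k"] by simp
    qed
    show "summable (\<lambda>n. (- freq n) ^ k * exp (- freq n * x))"
      using summable_psi_deriv[OF assms] by (rule summable_rabs_cancel)
    show "((\<lambda>x. (- freq n) ^ k * exp (- freq n * x)) has_real_derivative
        (- freq n) ^ Suc k * exp (- freq n * y)) (at y within {x / 2<..})" for n y
      by (auto intro!: derivative_eq_intros)
    show "x \<in> interior {x / 2<..}" using assms by (simp add: interior_open)
  qed (use assms in auto)
  then show ?thesis by (simp only: psi_deriv_def [abs_def])
qed

lemma deriv_psi_deriv: "x > 0 \<Longrightarrow> deriv (psi_deriv k) x = psi_deriv (Suc k) x"
  by (rule DERIV_imp_deriv[OF has_real_derivative_psi_deriv])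

lemma deriv_psi: "x > 0 \<Longrightarrow> deriv psi x = psi_deriv 1 x"
  by (simp add: psi_eq_psi_deriv deriv_psi_deriv)

lemma deriv_deriv_psi:
  assumes "x > 0"
  shows "deriv (deriv psi) x = psi_deriv 2 x"
proof -
  have "deriv (deriv psi) x = deriv (psi_deriv 1) x"
    using eventually_nhds_in_open[of "{0<..}" x] assms
    by (intro deriv_cong_ev refl) (auto elim!: eventually_mono simp: deriv_psi)
  then show ?thesis using assms by (simp add: deriv_psi_deriv eval_nat_numeral)
qed

lemma continuous_on_psi_deriv: "continuous_on {0<..} (psi_deriv k)"
  by (rule DERIV_continuous_on[where D = "psi_deriv (Suc k)"])
     (auto intro: has_field_derivative_at_within has_real_derivative_psi_deriv)

lemma psi_nonneg: "x > 0 \<Longrightarrow> psi x \<ge> 0"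
  using summable_rabs_cancel[OF summable_psi_deriv[of x 0]]
  by (simp add: psi_eq_psi_deriv psi_deriv_def suminf_nonneg)

text \<open>The theta inversion differentiated at its fixed point.\<close>

lemma psi_deriv_at_1: "4 * psi_deriv 1 1 + psi 1 = - 1 / 2"
proof -
  have der: "(psi has_real_derivative psi_deriv 1 1) (at 1)"
    using has_real_derivative_psi_deriv[of 1 0] by (simp add: psi_eq_psi_deriv)
  have der': "((\<lambda>x. psi (1 / x)) has_real_derivative - psi_deriv 1 1) (at 1)"
  proof -
    have "((\<lambda>x::real. 1 / x) has_real_derivative - 1) (at 1)"
      by (auto intro!: derivative_eq_intros)
    from DERIV_chain2[OF _ this, of psi "psi_deriv 1 1"] der show ?thesis by simp
  qed
  have 1: "((\<lambda>x. (1 + 2 * psi (1 / x)) / sqrt x) has_real_derivative - 2 * psi_deriv 1 1 - (1 + 2 * psi 1) / 2) (at 1)"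
    by (auto intro!: derivative_eq_intros der' simp: algebra_simps)
  have "((\<lambda>x. 1 + 2 * psi x) has_real_derivative - 2 * psi_deriv 1 1 - (1 + 2 * psi 1) / 2) (at 1)"
    by (rule has_field_derivative_transform_within_open[OF 1, of "{0<..}"])
       (auto intro: theta_inversion[symmetric])
  moreover have "((\<lambda>x. 1 + 2 * psi x) has_real_derivative 2 * psi_deriv 1 1) (at 1)"
    by (auto intro!: derivative_eq_intros der)
  ultimately have "2 * psi_deriv 1 1 = - 2 * psi_deriv 1 1 - (1 + 2 * psi 1) / 2"
    using DERIV_unique by blast
  then show ?thesis by (simp add: field_simps)
qed

section \<open>Interchange of sum and integral\<close>

lemma set_integrable_mult_bounded:
  fixes F :: "real \<Rightarrow> complex" and h :: "real \<Rightarrow> real"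
  assumes F: "set_integrable lborel A F" and h [measurable]: "h \<in> borel_measurable borel"
    and bound: "\<And>t. t \<in> A \<Longrightarrow> \<bar>h t\<bar> \<le> M"
  shows "set_integrable lborel A (\<lambda>t. F t * of_real (h t))"
    and "(LBINT t:A. norm (F t * of_real (h t))) \<le> M * (LBINT t:A. norm (F t))"
proof -
  have F': "integrable lborel (\<lambda>t. indicator A t *\<^sub>R F t)"
    using F by (simp add: set_integrable_def)
  then have [measurable]: "(\<lambda>t. indicator A t *\<^sub>R F t) \<in> borel_measurable borel" by simp
  have le: "norm ((indicator A t *\<^sub>R F t) * of_real (h t)) \<le> M * norm (indicator A t *\<^sub>R F t)" for t
    using bound[of t] by (auto simp: norm_mult indicator_def mult.commute[of M] intro: mult_left_mono)
  have int: "integrable lborel (\<lambda>t. (indicator A t *\<^sub>R F t) * of_real (h t))"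
  proof (rule Bochner_Integration.integrable_bound[OF integrable_mult_right[OF integrable_norm[OF F'], of M]])
    show "(\<lambda>t. (indicator A t *\<^sub>R F t) * of_real (h t)) \<in> borel_measurable lborel" by measurable
    show "AE t in lborel. norm ((indicator A t *\<^sub>R F t) * of_real (h t)) \<le> norm (M * norm (indicator A t *\<^sub>R F t))"
      using order.trans[OF le abs_ge_self] by simp
  qed
  then show "set_integrable lborel A (\<lambda>t. F t * of_real (h t))"
    by (simp add: set_integrable_def)
  have "(LBINT t. norm ((indicator A t *\<^sub>R F t) * of_real (h t))) \<le> (LBINT t. M * norm (indicator A t *\<^sub>R F t))"
    by (intro integral_mono integrable_norm int integrable_mult_right F' le)
  then show "(LBINT t:A. norm (F t * of_real (h t))) \<le> M * (LBINT t:A. norm (F t))"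
    by (simp add: set_lebesgue_integral_def norm_mult mult.assoc)
qed

text \<open>Since \<open>freq n \<ge> 1\<close>, for t \<ge> 1 the exponent freq n * t is at least
  t/2 + freq n / 2. The first half secures integrability against \<open>g\<close>, the second
  summability over n, so a single hypothesis on \<open>g\<close> covers all n and k. The factor
  \<open>h\<close> in the proof is the n-th term with exp(-t/2) divided out.\<close>

lemma
  fixes g :: "real \<Rightarrow> complex"
  assumes g: "set_integrable lborel {1..} (\<lambda>t. g t * of_real (exp (- t / 2)))"
  shows set_integrable_freq:
      "\<And>n. set_integrable lborel {1..} (\<lambda>t. g t * of_real ((- freq n) ^ k * exp (- freq n * t)))"
    and set_integrable_psi_deriv: "set_integrable lborel {1..} (\<lambda>t. g t * of_real (psi_deriv k t))"
    and sums_set_integral_psi_deriv: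
      "(\<lambda>n. LBINT t:{1..}. g t * of_real ((- freq n) ^ k * exp (- freq n * t))) sums
         (LBINT t:{1..}. g t * of_real (psi_deriv k t))"
proof -
  define h where "h n t = exp (t / 2) * ((- freq n) ^ k * exp (- freq n * t))" for n t
  define M where "M n = freq n ^ k * exp (- (1 / 2 * freq n))" for n
  have h_meas: "h n \<in> borel_measurable borel" for n
    unfolding h_def by measurable
  have h_le: "\<bar>h n t\<bar> \<le> M n" if "t \<in> {1..}" for n t
  proof -
    have "t / 2 + - freq n * t \<le> - (1 / 2 * freq n)"
    proof -
      have "freq n * 1 \<le> freq n * t" "1 * t \<le> freq n * t"
        using that freq_ge_1[of n] by (auto intro: mult_right_mono)
      then show ?thesis by simp
    qed
    then have "exp (t / 2) * exp (- freq n * t) \<le> exp (- (1 / 2 * freq n))"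
      by (simp flip: exp_add)
    then have "freq n ^ k * (exp (t / 2) * exp (- freq n * t)) \<le> M n"
      unfolding M_def using freq_pos[of n] by (intro mult_left_mono) auto
    then show ?thesis
      using freq_pos[of n] by (simp add: h_def abs_mult power_abs mult_ac)
  qed
  have eq: "g t * of_real (exp (- t / 2)) * of_real (h n t) = g t * of_real ((- freq n) ^ k * exp (- freq n * t))" for n t
  proof -
    have "exp (- t / 2) * h n t = (- freq n) ^ k * exp (- freq n * t)"
      by (simp add: h_def exp_minus field_simps)
    then show ?thesis by (simp only: mult.assoc flip: of_real_mult)
  qed
  note * = set_integrable_mult_bounded[OF g h_meas h_le, unfolded eq]
  show int: "set_integrable lborel {1..} (\<lambda>t. g t * of_real ((- freq n) ^ k * exp (- freq n * t)))" for n
    by (rule *(1))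
  define f where "f n t = indicator {1..} t *\<^sub>R (g t * of_real ((- freq n) ^ k * exp (- freq n * t)))" for n t
  have int': "integrable lborel (f n)" for n
    using int[of n] by (simp add: set_integrable_def f_def [abs_def])
  have summ: "summable (\<lambda>n. norm (f n t))" for t
    using summable_mult[OF summable_psi_deriv[of t k], of "norm (g t)"]
    by (cases "t \<ge> 1") (auto simp: f_def norm_mult abs_mult norm_power power_abs)
  have summ': "summable (\<lambda>n. LBINT t. norm (f n t))"
  proof (rule summable_comparison_test')
    show "summable (\<lambda>n. M n * (LBINT t:{1..}. norm (g t * of_real (exp (- t / 2)))))"
      unfolding M_def by (intro summable_mult2 summable_freq_power_exp) simp
    show "norm (LBINT t. norm (f n t)) \<le> M n * (LBINT t:{1..}. norm (g t * of_real (exp (- t / 2))))" for n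
      using *(2)[of n] by (simp add: f_def set_lebesgue_integral_def)
  qed
  have lim: "(\<Sum>n. f n t) = indicator {1..} t *\<^sub>R (g t * of_real (psi_deriv k t))" for t
  proof (cases "t \<ge> 1")
    case True
    then have "summable (\<lambda>n. (- freq n) ^ k * exp (- freq n * t))"
      by (intro summable_rabs_cancel[OF summable_psi_deriv]) simp
    from sums_mult[OF sums_of_real[OF summable_sums[OF this]], of "g t"] show ?thesis
      using True by (simp add: f_def psi_deriv_def sums_iff)
  qed (simp add: f_def)
  show "set_integrable lborel {1..} (\<lambda>t. g t * of_real (psi_deriv k t))"
    using integrable_suminf[OF int' _ summ'] summ by (simp add: lim set_integrable_def)
  show "(\<lambda>n. LBINT t:{1..}. g t * of_real ((- freq n) ^ k * exp (- freq n * t))) sums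
         (LBINT t:{1..}. g t * of_real (psi_deriv k t))"
    using sums_integral[OF int' _ summ'] summ
    unfolding lim by (simp add: set_lebesgue_integral_def f_def)
qed

lemma set_integrable_powr_exp:
  fixes a p :: real
  assumes "a > 0"
  shows "set_integrable lborel {1..} (\<lambda>t. t powr p * exp (- (a * t)))"
proof -
  \<comment> \<open>The Gamma integral with parameter q + 1 > 0 converges also at 0; on t \<ge> 1
    the larger exponent only increases the power.\<close>
  define q :: real where "q = max p 0"
  have "(\<lambda>t. complex_of_real t powr (of_real (q + 1) - 1) / of_real (exp (a * t))) absolutely_integrable_on {0<..}"
    using assms by (intro absolutely_integrable_Gamma_integral) (auto simp: q_def)
  then have "(\<lambda>t. complex_of_real t powr (of_real (q + 1) - 1) / of_real (exp (a * t))) absolutely_integrable_on {1..}"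
    by (rule set_integrable_subset) auto
  then have 1: "(\<lambda>t. norm (complex_of_real t powr (of_real (q + 1) - 1) / of_real (exp (a * t)))) absolutely_integrable_on {1..}"
    by (rule set_integrable_norm)
  have "(\<lambda>t. t powr p * exp (- (a * t))) absolutely_integrable_on {1..}"
  proof (rule set_integrable_bound[OF 1])
    have "(\<lambda>t. indicator {1..} t *\<^sub>R (t powr p * exp (- (a * t)))) \<in> borel_measurable lborel"
      by measurable
    then show "set_borel_measurable lebesgue {1..} (\<lambda>t. t powr p * exp (- (a * t)))"
      unfolding set_borel_measurable_def by (rule measurable_completion)
    have "t powr p \<le> t powr q" if "t \<ge> 1" for t
      using that by (intro powr_mono) (auto simp: q_def)
    then show "AE t in lebesgue. t \<in> {1..} \<longrightarrow> norm (t powr p * exp (- (a * t))) \<le>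
        norm (norm (complex_of_real t powr (of_real (q + 1) - 1) / of_real (exp (a * t))))"
      by (auto simp: norm_divide norm_powr_real_powr exp_minus divide_simps)
  qed
  then show ?thesis
    unfolding set_integrable_def by (subst (asm) integrable_completion) auto
qed

lemma set_integrable_exp_decay:
  fixes g :: "real \<Rightarrow> complex"
  assumes "continuous_on {1..} g" and le: "\<And>t. t \<ge> 1 \<Longrightarrow> norm (g t) \<le> K * t powr p"
  shows "set_integrable lborel {1..} (\<lambda>t. g t * of_real (exp (- t / 2)))"
proof (rule set_integrable_bound)
  show "set_integrable lborel {1..} (\<lambda>t. K * (t powr p * exp (- (1 / 2 * t))))"
    by (intro set_integrable_mult_right set_integrable_powr_exp) simp
  have cont: "continuous_on {1..} (\<lambda>t. g t * of_real (exp (- t / 2)))"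
    using assms(1) by (auto intro!: continuous_intros)
  show "set_borel_measurable lborel {1..} (\<lambda>t. g t * of_real (exp (- t / 2)))"
    using borel_measurable_continuous_on_indicator[OF _ cont] by (simp add: set_borel_measurable_def)
  have "norm (g t * of_real (exp (- t / 2))) \<le> norm (K * (t powr p * exp (- (1 / 2 * t))))" if "t \<in> {1..}" for t
  proof -
    have "norm (g t * of_real (exp (- t / 2))) = norm (g t) * exp (- t / 2)" by (simp add: norm_mult)
    also have "\<dots> \<le> K * t powr p * exp (- t / 2)" using that le by (intro mult_right_mono) auto
    also have "\<dots> \<le> norm (K * (t powr p * exp (- (1 / 2 * t))))"
      by (simp add: mult.assoc)
    finally show ?thesis .
  qed
  then show "AE t in lborel. t \<in> {1..} \<longrightarrow>
      norm (g t * of_real (exp (- t / 2))) \<le> norm (K * (t powr p * exp (- (1 / 2 * t))))" by auto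
qed

subsection \<open>The Mellin transform of psi\<close>

text \<open>The Gamma integral and the change of variables live on the completed measure; continuity
  supplies the Borel measurability needed to return to \<open>lborel\<close>.\<close>

lemma set_integrable_lborel_of_lebesgue:
  fixes f :: "real \<Rightarrow> complex"
  assumes "f absolutely_integrable_on S" "continuous_on S f" and S: "S \<in> sets borel"
  shows "set_integrable lborel S f" and "(LBINT t:S. f t) = integral S f"
proof -
  have "(\<lambda>t. indicator S t *\<^sub>R f t) \<in> borel_measurable lborel"
    using borel_measurable_continuous_on_indicator[OF S assms(2)] by simp
  then show int: "set_integrable lborel S f"
    using assms(1) unfolding set_integrable_def by (simp only: integrable_completion)
  then show "(LBINT t:S. f t) = integral S f"
    by (rule set_borel_integral_eq_integral(2))
qed

lemma set_integral_greaterThan_eq_atLeast: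
  fixes f :: "real \<Rightarrow> complex"
  shows "(LBINT t:{a<..}. f t) = (LBINT t:{a..}. f t)"
  by (rule set_integral_discrete_difference[where X = "{a}"]) auto

lemma set_integral_FTC_atLeast:
  fixes F f :: "real \<Rightarrow> complex"
  assumes der: "\<And>t. t > 0 \<Longrightarrow> (F has_vector_derivative f t) (at t)"
    and cont: "continuous_on {0<..} f"
    and int: "set_integrable lborel {1..} f" and lim: "(F \<longlongrightarrow> L) at_top"
  shows "(LBINT t:{1..}. f t) = L - F 1"
proof -
  have "(LBINT x=ereal 1..\<infinity>. f x) = L - F 1"
  proof (rule interval_integral_FTC_integrable)
    show "isCont f x" if "ereal 1 < ereal x" for x
      using cont that by (intro continuous_on_interior[of "{0<..}"]) (auto simp: interior_open)
    show "set_integrable lborel (einterval (ereal 1) \<infinity>) f"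
      using int by (rule set_integrable_subset) (auto simp: einterval_iff)
    have "isCont F 1"
      using der[of 1] by (intro has_vector_derivative_continuous) auto
    then show "((F \<circ> real_of_ereal) \<longlongrightarrow> F 1) (at_right (ereal 1))"
      by (auto simp: ereal_tendsto_simps continuous_at intro: tendsto_within_subset)
    show "((F \<circ> real_of_ereal) \<longlongrightarrow> L) (at_left \<infinity>)"
      using lim by (simp add: ereal_tendsto_simps)
  qed (use der in auto)
  then show ?thesis
    by (simp add: interval_integral_to_infinity_eq set_integral_greaterThan_eq_atLeast)
qed

lemma has_vector_derivative_of_real_powr:
  assumes "t > 0"
  shows "((\<lambda>t. complex_of_real t powr z) has_vector_derivative z * complex_of_real t powr (z - 1)) (at t)"
proof -
  have "((\<lambda>w. w powr z) has_field_derivative z * complex_of_real t powr (z - 1)) (at (complex_of_real t))"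
    using assms by (intro has_field_derivative_powr) auto
  from has_field_derivative_at_within[OF this] show ?thesis
    using has_vector_derivative_real_field by blast
qed

lemma continuous_on_of_real_powr: "continuous_on {0<..} (\<lambda>t. complex_of_real t powr z)"
  by (intro continuous_intros) auto

text \<open>These elementary integrals, at w = (s - 1)/2 and w = s/2, yield the polar part 1 / (s (s
  - 1)) of the Mellin transform.\<close>

lemma set_integral_powr_atLeast_1:
  assumes "Re w > 0"
  shows "set_integrable lborel {1..} (\<lambda>t. complex_of_real t powr (- w - 1))"
    and "(LBINT t:{1..}. complex_of_real t powr (- w - 1)) = 1 / w"
proof -
  have w: "w \<noteq> 0" using assms by auto
  have cont: "continuous_on {1..} (\<lambda>t. complex_of_real t powr (- w - 1))"
    by (rule continuous_on_subset[OF continuous_on_of_real_powr]) auto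
  have "((\<lambda>t. t powr (- Re w - 1)) has_integral - (1 powr (- Re w - 1 + 1)) / (- Re w - 1 + 1)) {1..}"
    using assms by (intro has_integral_powr_to_inf) auto
  then have 1: "(\<lambda>t. t powr (- Re w - 1)) absolutely_integrable_on {1..}"
    by (intro nonnegative_absolutely_integrable_1) (auto simp: integrable_on_def)
  have "(\<lambda>t. complex_of_real t powr (- w - 1)) absolutely_integrable_on {1..}"
  proof (rule set_integrable_bound[OF 1])
    show "set_borel_measurable lebesgue {1..} (\<lambda>t. complex_of_real t powr (- w - 1))"
      unfolding set_borel_measurable_def
      using borel_measurable_continuous_on_indicator[OF _ cont] by (intro measurable_completion) simp
  qed (auto simp: norm_powr_real_powr)
  from set_integrable_lborel_of_lebesgue(1)[OF this cont]
  show int: "set_integrable lborel {1..} (\<lambda>t. complex_of_real t powr (- w - 1))" by simp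
  have "(LBINT t:{1..}. complex_of_real t powr (- w - 1)) = 0 - complex_of_real 1 powr (- w) / (- w)"
  proof (rule set_integral_FTC_atLeast[where F = "\<lambda>t. complex_of_real t powr (- w) / (- w)", OF _ continuous_on_of_real_powr int])
    show "((\<lambda>t. complex_of_real t powr (- w) / (- w)) has_vector_derivative complex_of_real t powr (- w - 1)) (at t)"
      if "t > 0" for t
      using has_vector_derivative_divide[OF has_vector_derivative_of_real_powr[OF that, of "- w"], of "- w"] w by simp
    have "((\<lambda>t. norm (complex_of_real t powr (- w))) \<longlongrightarrow> 0) at_top"
    proof (rule Lim_transform_eventually)
      show "((\<lambda>t. t powr (- Re w)) \<longlongrightarrow> 0) at_top"
        using assms by (intro tendsto_neg_powr) (auto simp: filterlim_ident)
      show "\<forall>\<^sub>F t in at_top. t powr (- Re w) = norm (complex_of_real t powr (- w))"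
        using eventually_gt_at_top[of 0] by eventually_elim (simp add: norm_powr_real_powr)
    qed
    then have "((\<lambda>t. complex_of_real t powr (- w)) \<longlongrightarrow> 0) at_top"
      by (simp only: tendsto_norm_zero_iff)
    then show "((\<lambda>t. complex_of_real t powr (- w) / (- w)) \<longlongrightarrow> 0) at_top"
      using tendsto_divide[OF _ tendsto_const, of _ 0 _ "- w"] w by fastforce
  qed
  then show "(LBINT t:{1..}. complex_of_real t powr (- w - 1)) = 1 / w" by simp
qed

text \<open>Euler's integral under the substitution of a t for the variable.\<close>

lemma set_integral_Gamma_scaled:
  fixes a :: real
  assumes z: "Re z > 0" and a: "a > 0"
  shows "set_integrable lborel {0<..} (\<lambda>t. complex_of_real t powr (z - 1) * of_real (exp (- a * t)))"
    and "(LBINT t:{0<..}. complex_of_real t powr (z - 1) * of_real (exp (- a * t))) = Gamma z / of_real a powr z"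
proof -
  define f where "f t = complex_of_real t powr (z - 1) / of_real (exp t)" for t
  define F where "F t = complex_of_real t powr (z - 1) * of_real (exp (- a * t))" for t
  have img: "(*) a ` {0<..} = {0<..}"
  proof (intro equalityI subsetI)
    fix x :: real assume "x \<in> {0<..}"
    then have "x = a * (x / a)" "x / a \<in> {0<..}" using a by auto
    then show "x \<in> (*) a ` {0<..}" by blast
  qed (use a in auto)
  have "f absolutely_integrable_on {0<..}" "integral {0<..} f = Gamma z"
    using absolutely_integrable_Gamma_integral'[OF z] Gamma_integral_complex'[OF z]
    by (simp_all add: f_def [abs_def] integral_unique)
  then have "f absolutely_integrable_on (*) a ` {0<..} \<and> integral ((*) a ` {0<..}) f = Gamma z"
    by (simp only: img)
  then have *: "(\<lambda>t. \<bar>a\<bar> *\<^sub>R f (a * t)) absolutely_integrable_on {0<..} \<and>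
      integral {0<..} (\<lambda>t. \<bar>a\<bar> *\<^sub>R f (a * t)) = Gamma z"
    using a by (subst has_absolute_integral_change_of_variables_real)
      (auto intro!: derivative_eq_intros simp: inj_on_def)
  have eq: "\<bar>a\<bar> *\<^sub>R f (a * t) = of_real a powr z * F t" if "t \<in> {0<..}" for t
  proof -
    have "complex_of_real (a * t) powr (z - 1) = of_real a powr (z - 1) * of_real t powr (z - 1)"
      using a that by (simp add: powr_times_real)
    moreover have "of_real a * complex_of_real a powr (z - 1) = of_real a powr z"
      using a by (simp add: powr_diff)
    ultimately show ?thesis
      using a by (simp add: f_def F_def scaleR_conv_of_real exp_minus divide_inverse mult.assoc[symmetric]
          exp_of_real[symmetric] del: of_real_mult)
  qed
  have cont: "continuous_on {0<..} F"
    unfolding F_def by (intro continuous_intros continuous_on_of_real_powr)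
  have "(\<lambda>t. of_real a powr z * F t) absolutely_integrable_on {0<..} \<longleftrightarrow>
      (\<lambda>t. \<bar>a\<bar> *\<^sub>R f (a * t)) absolutely_integrable_on {0<..}"
    by (intro set_integrable_cong refl eq[symmetric])
  with * have "(\<lambda>t. of_real a powr z * F t) absolutely_integrable_on {0<..}" by blast
  then have int: "F absolutely_integrable_on {0<..}"
    using a by (simp add: powr_def)
  note lborel = set_integrable_lborel_of_lebesgue[OF this cont]
  show "set_integrable lborel {0<..} F" by (rule lborel(1)) simp
  have "of_real a powr z * integral {0<..} F = integral {0<..} (\<lambda>t. of_real a powr z * F t)"
    by simp
  also have "\<dots> = integral {0<..} (\<lambda>t. \<bar>a\<bar> *\<^sub>R f (a * t))"
    by (rule integral_cong) (simp add: eq)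
  finally have "of_real a powr z * integral {0<..} F = Gamma z"
    using * by (simp only:)
  then show "(LBINT t:{0<..}. F t) = Gamma z / of_real a powr z"
    using lborel(2) a by (simp add: field_simps)
qed

text \<open>The term exp(-pi n^2 t) has the Mellin transform Gamma(s/2) pi^(-s/2) n^(-s), so the
  series for \<open>psi\<close> becomes the Dirichlet series.\<close>

lemma mellin_transform_psi:
  assumes s: "Re s > 1"
  shows "set_integrable lborel {0<..} (\<lambda>t. complex_of_real t powr (s / 2 - 1) * of_real (psi t))"
    and "(\<lambda>n. 1 / of_nat (Suc n) powr s) sums
      (of_real pi powr (s / 2) * rGamma (s / 2) * (LBINT t:{0<..}. complex_of_real t powr (s / 2 - 1) * of_real (psi t)))"
proof -
  define F where "F n t = complex_of_real t powr (s / 2 - 1) * of_real (exp (- freq n * t))" for n t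
  define f where "f n t = indicator {0<..} t *\<^sub>R F n t" for n t
  have z: "Re (s / 2) > 0" using s by simp
  have int: "integrable lborel (f n)" for n
    using set_integral_Gamma_scaled(1)[OF z freq_pos[of n]]
    by (simp add: f_def [abs_def] F_def set_integrable_def)
  \<comment> \<open>The base is a positive real, so the principal logarithm of the square is twice
    the logarithm and no branch correction appears.\<close>
  have freq_powr: "complex_of_real (freq n) powr (w / 2) = of_real pi powr (w / 2) * of_nat (Suc n) powr w" for n w
  proof -
    have "complex_of_real (freq n) powr (w / 2) = of_real pi powr (w / 2) * complex_of_real ((real (Suc n))\<^sup>2) powr (w / 2)"
      unfolding freq_def by (subst powr_times_real[symmetric]) (auto simp del: of_nat_Suc)
    also have "complex_of_real ((real (Suc n))\<^sup>2) powr (w / 2) = of_nat (Suc n) powr w"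
      by (simp add: powr_def Ln_of_real ln_realpow Ln_of_nat del: of_nat_Suc of_real_power)
    finally show ?thesis .
  qed
  have val: "(LBINT t. f n t) = Gamma (s / 2) / of_real pi powr (s / 2) * (1 / of_nat (Suc n) powr s)" for n
    using set_integral_Gamma_scaled(2)[OF z freq_pos[of n]]
    by (simp add: f_def F_def set_lebesgue_integral_def freq_powr del: of_nat_Suc)
  \<comment> \<open>The norm of the integrand is the same integrand at the real point Re s, so the
    same formula evaluates it; summability over n is then exactly where Re s > 1 enters.\<close>
  have norm_val: "(LBINT t. norm (f n t)) = norm (Gamma (complex_of_real (Re s) / 2) / of_real pi powr (of_real (Re s) / 2)) * real (Suc n) powr (- Re s)" for n
  proof -
    have z': "Re (of_real (Re s) / 2 :: complex) > 0" using s by simp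
    have eq: "indicator {0<..} t *\<^sub>R (complex_of_real t powr (of_real (Re s) / 2 - 1) * of_real (exp (- freq n * t))) =
        complex_of_real (norm (f n t))" for t
    proof (cases "t > 0")
      case True
      have "complex_of_real t powr (of_real (Re s) / 2 - 1) = of_real (t powr (Re s / 2 - 1))"
        using True by (subst powr_of_real[symmetric]) auto
      then show ?thesis using True by (simp add: f_def F_def norm_mult norm_powr_real_powr)
    qed (simp add: f_def)
    have "complex_of_real (LBINT t. norm (f n t)) = Gamma (of_real (Re s) / 2) / of_real (freq n) powr (of_real (Re s) / 2)"
      using set_integral_Gamma_scaled(2)[OF z' freq_pos[of n]] unfolding set_lebesgue_integral_def eq by simp
    then have "norm (complex_of_real (LBINT t. norm (f n t))) = norm (Gamma (complex_of_real (Re s) / 2) / of_real (freq n) powr (of_real (Re s) / 2))"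
      by (simp only:)
    also have "\<dots> = norm (Gamma (complex_of_real (Re s) / 2) / of_real pi powr (of_real (Re s) / 2)) *
        real (Suc n) powr (- Re s)"
    proof -
      have "norm (of_nat (Suc n) powr complex_of_real (Re s)) = real (Suc n) powr Re s"
        by (subst norm_powr_real_powr) (simp_all del: of_nat_Suc)
      then show ?thesis
        unfolding freq_powr norm_divide norm_mult
        by (simp only: powr_minus divide_inverse inverse_mult_distrib mult.assoc)
    qed
    also have "norm (complex_of_real (LBINT t. norm (f n t))) = (LBINT t. norm (f n t))"
      by (simp add: integral_nonneg_AE)
    finally show ?thesis .
  qed
  have "summable (\<lambda>n. real (Suc n) powr (- Re s))"
    using s summable_real_powr_iff[of "- Re s"] by (subst summable_Suc_iff) auto
  then have summ': "summable (\<lambda>n. LBINT t. norm (f n t))"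
    unfolding norm_val by (rule summable_mult)
  have summ: "summable (\<lambda>n. norm (f n t))" for t
    using summable_mult[OF summable_psi_deriv[of t 0], of "norm (complex_of_real t powr (s / 2 - 1))"]
    by (cases "t > 0") (auto simp: f_def F_def norm_mult)
  have lim: "(\<Sum>n. f n t) = indicator {0<..} t *\<^sub>R (complex_of_real t powr (s / 2 - 1) * of_real (psi t))" for t
  proof (cases "t > 0")
    case True
    then have "summable (\<lambda>n. (- freq n) ^ 0 * exp (- freq n * t))"
      by (intro summable_rabs_cancel[OF summable_psi_deriv]) simp
    from sums_mult[OF sums_of_real[OF summable_sums[OF this]], of "complex_of_real t powr (s / 2 - 1)"] show ?thesis
      using True by (simp add: f_def F_def psi_eq_psi_deriv psi_deriv_def sums_iff)
  qed (simp add: f_def)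
  show "set_integrable lborel {0<..} (\<lambda>t. complex_of_real t powr (s / 2 - 1) * of_real (psi t))"
    using integrable_suminf[OF int _ summ'] summ by (simp add: lim set_integrable_def)
  have "(\<lambda>n. Gamma (s / 2) / of_real pi powr (s / 2) * (1 / of_nat (Suc n) powr s)) sums
         (LBINT t:{0<..}. complex_of_real t powr (s / 2 - 1) * of_real (psi t))"
    using sums_integral[OF int _ summ'] summ
    unfolding lim val by (simp add: set_lebesgue_integral_def)
  from sums_mult[OF this, of "of_real pi powr (s / 2) * rGamma (s / 2)"]
  have "(\<lambda>n. of_real pi powr (s / 2) * rGamma (s / 2) * (Gamma (s / 2) / of_real pi powr (s / 2) * (1 / of_nat (Suc n) powr s))) sums
     (of_real pi powr (s / 2) * rGamma (s / 2) * (LBINT t:{0<..}. complex_of_real t powr (s / 2 - 1) * of_real (psi t)))" .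
  moreover have "of_real pi powr (s / 2) * rGamma (s / 2) * (Gamma (s / 2) / of_real pi powr (s / 2) * c) = c" for c
  proof -
    have "Gamma (s / 2) \<noteq> 0"
      using z by (auto simp: Gamma_eq_zero_iff elim!: nonpos_Ints_cases)
    then show ?thesis by (simp add: rGamma_inverse_Gamma powr_def)
  qed
  ultimately show "(\<lambda>n. 1 / of_nat (Suc n) powr s) sums
      (of_real pi powr (s / 2) * rGamma (s / 2) * (LBINT t:{0<..}. complex_of_real t powr (s / 2 - 1) * of_real (psi t)))"
    by (simp only:)
qed

text \<open>The part of the Mellin integral away from 0. By the exponential decay of
  \<open>psi\<close> it converges for every s, which makes it the building block of the
  continuation.\<close>

definition half_mellin :: "complex \<Rightarrow> complex" where
  "half_mellin s = (LBINT t:{1..}. complex_of_real t powr (s / 2 - 1) * of_real (psi t))"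

lemma set_integrable_powr_exp_half: "set_integrable lborel {1..} (\<lambda>t. complex_of_real t powr z * of_real (exp (- t / 2)))"
  by (rule set_integrable_exp_decay[where K = 1 and p = "Re z"])
     (auto simp: norm_powr_real_powr intro: continuous_on_subset[OF continuous_on_of_real_powr])

lemma set_integrable_half_mellin:
  "set_integrable lborel {1..} (\<lambda>t. complex_of_real t powr z * of_real (psi t))"
  unfolding psi_eq_psi_deriv by (rule set_integrable_psi_deriv[OF set_integrable_powr_exp_half])

text \<open>On (0,1) substitute t = 1/u and use psi(1/u) = sqrt u * psi(u) + (sqrt u - 1)/2. The
  first summand gives \<open>half_mellin (1 - s)\<close>, the second two pure powers with integrals
  1/(s - 1) and 1/s, up to sign.\<close>

lemma mellin_transform_psi_split:
  assumes s: "Re s > 1"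
  shows "(LBINT t:{0<..}. complex_of_real t powr (s / 2 - 1) * of_real (psi t)) =
    1 / (s * (s - 1)) + half_mellin s + half_mellin (1 - s)"
proof -
  define f where "f t = complex_of_real t powr (s / 2 - 1) * of_real (psi t)" for t
  \<comment> \<open>The integrand on (0,1) after the substitution, including the Jacobian
    1/u^2.\<close>
  define G where "G u = complex_of_real u powr ((1 - s) / 2 - 1) * of_real (psi u) +
      1 / 2 * (of_real u powr (- ((s - 1) / 2) - 1) - of_real u powr (- (s / 2) - 1))" for u
  have s0: "s \<noteq> 0" "s \<noteq> 1" using s by auto
  have w: "Re ((s - 1) / 2) > 0" "Re (s / 2) > 0" using s by simp_all
  note p1 = set_integral_powr_atLeast_1[OF w(1)] and p2 = set_integral_powr_atLeast_1[OF w(2)]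
  have int_G: "set_integrable lborel {1..} G"
    unfolding G_def using p1(1) p2(1)
    by (intro set_integral_add(1) set_integrable_half_mellin set_integrable_mult_right set_integral_diff(1))
  have "(LBINT u:{1..}. G u) = half_mellin (1 - s) + 1 / 2 * (1 / ((s - 1) / 2) - 1 / (s / 2))"
    unfolding G_def half_mellin_def
    by (subst set_integral_add(2), (intro set_integrable_half_mellin set_integrable_mult_right set_integral_diff(1) p1 p2)+,
        subst set_integral_mult_right, subst set_integral_diff(2), (intro p1 p2)+) (simp only: p1 p2)
  also have "1 / 2 * (1 / ((s - 1) / 2) - 1 / (s / 2)) = 1 / (s * (s - 1))"
    using s0 by (simp add: field_simps)
  finally have G_val: "(LBINT u:{1..}. G u) = half_mellin (1 - s) + 1 / (s * (s - 1))" .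
  have img: "(\<lambda>u. 1 / u) ` {1<..} = {0<..<1::real}"
  proof (intro equalityI subsetI)
    fix x :: real assume "x \<in> {0<..<1}"
    then have "x = 1 / (1 / x)" "1 / x \<in> {1<..}" by (auto simp: field_simps)
    then show "x \<in> (\<lambda>u. 1 / u) ` {1<..}" by blast
  qed auto
  have int_f: "set_integrable lborel {0<..} f"
    using mellin_transform_psi(1)[OF s] by (simp add: f_def [abs_def])
  have cont_f: "continuous_on {0<..} f"
    unfolding f_def psi_eq_psi_deriv
    by (intro continuous_intros continuous_on_of_real_powr continuous_on_psi_deriv)
  have int01: "set_integrable lborel {0<..<1} f"
    using int_f by (rule set_integrable_subset) auto
  then have "f absolutely_integrable_on {0<..<1}"
    unfolding set_integrable_def by (subst integrable_completion) auto
  moreover have "(LBINT t:{0<..<1}. f t) = integral {0<..<1} f"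
    using int01 by (rule set_borel_integral_eq_integral(2))
  ultimately have "f absolutely_integrable_on (\<lambda>u. 1 / u) ` {1<..} \<and>
      integral ((\<lambda>u. 1 / u) ` {1<..}) f = (LBINT t:{0<..<1}. f t)"
    by (simp only: img)
  then have *: "(\<lambda>u. \<bar>- (1 / u\<^sup>2)\<bar> *\<^sub>R f (1 / u)) absolutely_integrable_on {1<..} \<and>
      integral {1<..} (\<lambda>u. \<bar>- (1 / u\<^sup>2)\<bar> *\<^sub>R f (1 / u)) = (LBINT t:{0<..<1}. f t)"
    by (subst has_absolute_integral_change_of_variables_real)
      (auto intro!: derivative_eq_intros simp: inj_on_def power2_eq_square)
  have eq: "\<bar>- (1 / u\<^sup>2)\<bar> *\<^sub>R f (1 / u) = G u" if "u \<in> {1<..}" for u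
  proof -
    define U where "U = complex_of_real u"
    have u: "u > 0" and U: "U \<noteq> 0" using that by (auto simp: U_def)
    have "psi (1 / u) = sqrt u * psi u + (sqrt u - 1) / 2"
      using theta_inversion[OF u] u by (simp add: field_simps)
    moreover have "complex_of_real (sqrt u) = U powr (1 / 2)"
      using u by (simp add: U_def powr_of_real[symmetric] powr_half_sqrt[symmetric])
    ultimately have psi: "complex_of_real (psi (1 / u)) = U powr (1 / 2) * of_real (psi u) + (U powr (1 / 2) - 1) / 2"
      by simp
    have inv: "complex_of_real (1 / u) powr (s / 2 - 1) = U powr (1 - s / 2)"
    proof -
      have "complex_of_real (1 / u) powr (s / 2 - 1) = exp ((s / 2 - 1) * of_real (ln (1 / u)))"
        using u by (simp add: powr_def Ln_of_real flip: of_real_divide)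
      also have "\<dots> = U powr (1 - s / 2)"
        using u by (simp add: powr_def U_def Ln_of_real ln_div algebra_simps)
      finally show ?thesis .
    qed
    have sq: "complex_of_real \<bar>- (1 / u\<^sup>2)\<bar> = U powr (- 2)"
      using u by (simp add: U_def powr_minus powr_numeral inverse_eq_divide)
    have pow: "U powr a * U powr b = U powr (a + b)" for a b
      by (simp add: powr_add)
    have "\<bar>- (1 / u\<^sup>2)\<bar> *\<^sub>R f (1 / u) =
        U powr (- 2) * (U powr (1 - s / 2) * (U powr (1 / 2) * of_real (psi u) + (U powr (1 / 2) - 1) / 2))"
      by (simp only: f_def scaleR_conv_of_real sq inv psi)
    also have "\<dots> = U powr (- 2) * U powr (1 - s / 2) * U powr (1 / 2) * of_real (psi u) +
        1 / 2 * (U powr (- 2) * U powr (1 - s / 2) * U powr (1 / 2) - U powr (- 2) * U powr (1 - s / 2))"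
    proof -
      have "P * (Q * (R * p + (R - 1) / 2)) = P * Q * R * p + 1 / 2 * (P * Q * R - P * Q)" for P Q R p :: complex
        by (simp add: field_simps)
      then show ?thesis .
    qed
    also have "\<dots> = G u"
      unfolding pow G_def U_def[symmetric] by (simp add: field_simps)
    finally show ?thesis .
  qed
  have "(LBINT t:{0<..<1}. f t) = integral {1<..} G"
    using * eq by (metis (no_types, lifting) integral_cong)
  also have "\<dots> = (LBINT u:{1<..}. G u)"
  proof -
    have "set_integrable lborel {1<..} G"
      using int_G by (rule set_integrable_subset) auto
    then show ?thesis by (simp add: set_borel_integral_eq_integral(2))
  qed
  finally have left: "(LBINT t:{0<..<1}. f t) = half_mellin (1 - s) + 1 / (s * (s - 1))"
    by (simp only: set_integral_greaterThan_eq_atLeast G_val)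
  have split: "{0<..} = {0<..<1} \<union> {1::real..}" by auto
  have "(LBINT t:{0<..}. f t) = (LBINT t:{0<..<1}. f t) + (LBINT t:{1..}. f t)"
    unfolding split
    by (rule set_integral_Un) (auto intro: int01 set_integrable_subset[OF int_f])
  then show ?thesis
    unfolding left by (simp add: f_def half_mellin_def)
qed

subsection \<open>Analytic continuation of zeta and the formula for Xi\<close>

text \<open>Expands t^(s/2) = exp(s ln t / 2) under the integral. The partial sums are dominated by
  t^(|s|/2) times the remaining weight, which is integrable for every s. An everywhere convergent
  power series gives holomorphy at once.\<close>

lemma half_mellin_power_series:
  "(\<lambda>k. (LBINT t:{1..}. complex_of_real t powr (- 1) * of_real (psi t) * of_real ((ln t / 2) ^ k / fact k)) * s ^ k)
     sums half_mellin s"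
proof -
  define g where "g t = indicator {1..} t *\<^sub>R (complex_of_real t powr (- 1) * of_real (psi t))" for t
  define T where "T k t = g t * of_real ((ln t / 2) ^ k / fact k)" for k t
  have g_0: "g t = 0" if "t < 1" for t
    using that by (simp add: g_def)
  have g_norm: "norm (g t) = psi t / t" if "t \<ge> 1" for t
    using that psi_nonneg[of t] by (simp add: g_def norm_mult norm_divide norm_powr_real_powr powr_minus_divide)
  have w_int: "integrable lborel (\<lambda>t. norm (g t) * t powr r)" for r
  proof -
    have "integrable lborel (\<lambda>t. norm (indicator {1..} t *\<^sub>R (complex_of_real t powr (of_real (r - 1)) * of_real (psi t))))"
      using set_integrable_half_mellin by (intro integrable_norm) (simp add: set_integrable_def)
    also have "(\<lambda>t. norm (indicator {1..} t *\<^sub>R (complex_of_real t powr (of_real (r - 1)) * of_real (psi t)))) =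
        (\<lambda>t. norm (g t) * t powr r)"
    proof
      fix t
      show "norm (indicator {1..} t *\<^sub>R (complex_of_real t powr (of_real (r - 1)) * of_real (psi t))) =
        norm (g t) * t powr r"
        by (cases "t \<ge> 1")
          (auto simp: g_norm g_0 norm_mult norm_divide norm_powr_real_powr powr_diff psi_nonneg)
    qed
    finally show ?thesis .
  qed
  have g_meas: "g \<in> borel_measurable borel"
    using set_integrable_half_mellin[of "- 1"] unfolding set_integrable_def g_def [abs_def, symmetric]
    by simp
  have T_meas: "T k \<in> borel_measurable borel" for k
    unfolding T_def using g_meas by measurable
  \<comment> \<open>A single term of the exponential series of ln t / 2 is at most its sum sqrt t;
    this makes every coefficient integrable.\<close>
  have T_le: "norm (T k t) \<le> norm (g t) * t powr (1 / 2)" for k t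
  proof (cases "t \<ge> 1")
    case True
    have "(ln t / 2) ^ k / fact k \<le> exp (ln t / 2)"
      using power_le_fact_exp[of "ln t / 2" k] True by (simp add: field_simps)
    also have "\<dots> = t powr (1 / 2)" using True by (simp add: powr_def)
    finally have "norm (g t) * ((ln t / 2) ^ k / fact k) \<le> norm (g t) * t powr (1 / 2)"
      by (intro mult_left_mono) auto
    then show ?thesis using True
      by (simp add: T_def norm_mult norm_divide norm_power)
  qed (simp add: T_def g_0)
  have T_int: "integrable lborel (T k)" for k
    by (rule Bochner_Integration.integrable_bound[OF w_int[of "1 / 2"]])
       (use T_meas T_le in \<open>auto intro: order.trans[OF _ abs_ge_self]\<close>)
  have "(\<lambda>N. LBINT t. \<Sum>k<N. T k t * s ^ k) \<longlonglongrightarrow>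
      (LBINT t. indicator {1..} t *\<^sub>R (complex_of_real t powr (s / 2 - 1) * of_real (psi t)))"
  proof (rule integral_dominated_convergence[OF _ _ w_int[of "norm s / 2"]])
    show "(\<lambda>t. indicator {1..} t *\<^sub>R (complex_of_real t powr (s / 2 - 1) * of_real (psi t))) \<in> borel_measurable lborel"
      using set_integrable_half_mellin[of "s / 2 - 1"] unfolding set_integrable_def by simp
    show "(\<lambda>t. \<Sum>k<N. T k t * s ^ k) \<in> borel_measurable lborel" for N
      using T_meas by measurable
    have "(\<lambda>N. \<Sum>k<N. T k t * s ^ k) \<longlonglongrightarrow>
        indicator {1..} t *\<^sub>R (complex_of_real t powr (s / 2 - 1) * of_real (psi t))" for t
    proof (cases "t \<ge> 1")
      case True
      have "(\<lambda>k. g t * ((s / 2 * of_real (ln t)) ^ k /\<^sub>R fact k)) sums (g t * exp (s / 2 * of_real (ln t)))"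
        by (intro sums_mult exp_converges)
      also have "(\<lambda>k. g t * ((s / 2 * of_real (ln t)) ^ k /\<^sub>R fact k)) = (\<lambda>k. T k t * s ^ k)"
      proof
        fix k
        have "s / 2 * complex_of_real (ln t) = of_real (ln t / 2) * s" by simp
        then have "(s / 2 * complex_of_real (ln t)) ^ k = of_real ((ln t / 2) ^ k) * s ^ k"
          by (simp only: power_mult_distrib of_real_power)
        then show "g t * ((s / 2 * complex_of_real (ln t)) ^ k /\<^sub>R fact k) = T k t * s ^ k"
          by (simp only: T_def) (simp add: scaleR_conv_of_real field_simps)
      qed
      also have "g t * exp (s / 2 * of_real (ln t)) =
          indicator {1..} t *\<^sub>R (complex_of_real t powr (s / 2 - 1) * of_real (psi t))"
      proof -
        have "complex_of_real t powr (s / 2 - 1) = of_real t powr (- 1) * exp (s / 2 * of_real (ln t))"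
          using True by (simp only: powr_def) (simp add: Ln_of_real exp_add[symmetric] algebra_simps)
        then show ?thesis using True by (simp add: g_def)
      qed
      finally show ?thesis by (simp add: sums_def)
    qed (simp add: T_def g_0)
    then show "AE t in lborel. (\<lambda>N. \<Sum>k<N. T k t * s ^ k) \<longlonglongrightarrow>
        indicator {1..} t *\<^sub>R (complex_of_real t powr (s / 2 - 1) * of_real (psi t))" by simp
    have "norm (\<Sum>k<N. T k t * s ^ k) \<le> norm (g t) * t powr (norm s / 2)" for N t
    proof (cases "t \<ge> 1")
      case True
      define x where "x = norm s * (ln t / 2)"
      have x: "x \<ge> 0" using True by (simp add: x_def)
      have "norm (\<Sum>k<N. T k t * s ^ k) \<le> (\<Sum>k<N. norm (g t) * (x ^ k /\<^sub>R fact k))"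
      proof (rule order.trans[OF norm_sum sum_mono])
        fix k
        have "norm (T k t * s ^ k) = norm (g t) * ((ln t / 2) ^ k / fact k) * norm s ^ k"
          using True by (simp add: T_def norm_mult norm_divide norm_power)
        also have "\<dots> = norm (g t) * (x ^ k /\<^sub>R fact k)"
          by (simp add: x_def power_mult_distrib field_simps)
        finally show "norm (T k t * s ^ k) \<le> norm (g t) * (x ^ k /\<^sub>R fact k)" by simp
      qed
      also have "\<dots> = norm (g t) * (\<Sum>k<N. x ^ k /\<^sub>R fact k)"
        by (simp add: sum_distrib_left)
      also have "(\<Sum>k<N. x ^ k /\<^sub>R fact k) \<le> exp x"
        unfolding exp_def using x by (intro sum_le_suminf summable_exp_generic) auto
      also have "exp x = t powr (norm s / 2)"
        using True by (simp add: powr_def x_def mult.commute)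
      finally show ?thesis by (simp add: mult_left_mono)
    qed (simp add: T_def g_0)
    then show "AE t in lborel. norm (\<Sum>k<N. T k t * s ^ k) \<le> norm (g t) * t powr (norm s / 2)" for N by simp
  qed
  also have "(\<lambda>N. LBINT t. \<Sum>k<N. T k t * s ^ k) = (\<lambda>N. \<Sum>k<N. (LBINT t. T k t) * s ^ k)"
    using T_int by (simp add: Bochner_Integration.integral_sum)
  also have "(\<lambda>k. LBINT t. T k t) =
      (\<lambda>k. LBINT t:{1..}. complex_of_real t powr (- 1) * of_real (psi t) * of_real ((ln t / 2) ^ k / fact k))"
    by (simp add: T_def g_def set_lebesgue_integral_def)
  finally show ?thesis
    by (simp add: sums_def half_mellin_def set_lebesgue_integral_def)
qed

lemma half_mellin_holomorphic: "half_mellin holomorphic_on A"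
proof -
  have "half_mellin field_differentiable at s" for s
  proof -
    have "half_mellin holomorphic_on ball 0 (norm s + 1)"
      by (rule power_series_holomorphic, subst diff_zero, rule half_mellin_power_series)
    then show ?thesis
      by (rule holomorphic_on_imp_differentiable_at) auto
  qed
  then show ?thesis
    by (auto simp: holomorphic_on_def intro: field_differentiable_at_within)
qed

text \<open>The Mellin formula with rGamma(s/2) rewritten as (s/2) rGamma(1 + s/2): the factor s/2
  removes the apparent pole at 0, and only the division by s - 1 remains.\<close>

definition zeta_continuation :: "complex \<Rightarrow> complex" where
  "zeta_continuation s = of_real pi powr (s / 2) * rGamma (1 + s / 2) *
     (1 / 2 + s * (s - 1) / 2 * (half_mellin s + half_mellin (1 - s))) / (s - 1)"

lemma zeta_continuation_holomorphic: "zeta_continuation holomorphic_on (- {1})"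
proof -
  have "(half_mellin \<circ> (\<lambda>s. 1 - s)) holomorphic_on (- {1})"
    by (intro holomorphic_on_compose half_mellin_holomorphic holomorphic_intros)
  then have "(\<lambda>s. half_mellin (1 - s)) holomorphic_on (- {1})" by (simp add: o_def)
  then show ?thesis
    unfolding zeta_continuation_def
    by (intro holomorphic_intros half_mellin_holomorphic) auto
qed

lemma zeta_continuation_sums:
  assumes "Re s > 1"
  shows "(\<lambda>n. 1 / of_nat (Suc n) powr s) sums zeta_continuation s"
proof -
  have s: "s \<noteq> 0" "s \<noteq> 1" using assms by auto
  have rG: "rGamma (s / 2) = s / 2 * rGamma (1 + s / 2)"
    using rGamma_plus1[of "s / 2"] by (simp add: add.commute)
  have "of_real pi powr (s / 2) * rGamma (s / 2) * (1 / (s * (s - 1)) + half_mellin s + half_mellin (1 - s)) =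
      zeta_continuation s"
    unfolding rG zeta_continuation_def using s by (simp add: field_simps)
  then show ?thesis
    using mellin_transform_psi(2)[OF assms] unfolding mellin_transform_psi_split[OF assms] by simp
qed

text \<open>\<open>zeta_continuation\<close> witnesses that the choice in \<open>zeta\<close> is not
  vacuous; the identity theorem on the connected punctured plane then forces the chosen function to
  agree with it.\<close>

lemma zeta_eq_zeta_continuation:
  assumes "s \<noteq> 1"
  shows "zeta s = zeta_continuation s"
proof -
  let ?P = "\<lambda>f. f holomorphic_on (- {1}) \<and>
     (\<forall>s. 1 < Re s \<longrightarrow> (\<lambda>n. 1 / of_nat (Suc n) powr s) sums f s)"
  have "?P zeta_continuation"
    using zeta_continuation_holomorphic zeta_continuation_sums by blast
  then have zeta: "?P zeta" unfolding zeta_def by (rule someI[of ?P])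
  show ?thesis
  proof (rule analytic_continuation_open[of "{s. Re s > 1}" "- {1}" zeta zeta_continuation])
    show "open {s. 1 < Re s}" by (rule open_halfspace_Re_gt)
    show "{s. 1 < Re s} \<noteq> {}" by (auto intro!: exI[of _ 2])
    show "connected (- {1::complex})" by (rule connected_punctured_universe) simp
    show "zeta z = zeta_continuation z" if "z \<in> {s. 1 < Re s}" for z
      using that zeta zeta_continuation_sums[of z] by (auto intro: sums_unique2)
  qed (use zeta zeta_continuation_holomorphic assms in auto)
qed

lemma riemann_xi_eq:
  assumes "0 < Re s" "Re s < 1"
  shows "riemann_xi s = 1 / 2 + s * (s - 1) / 2 * (half_mellin s + half_mellin (1 - s))"
proof -
  have s: "s \<noteq> 1" using assms by auto
  \<comment> \<open>\<open>Gamma\<close> takes the default value 0 exactly at its poles, so this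
    says that 1 + s/2 is not a pole and \<open>rGamma\<close> is a true reciprocal there.\<close>
  have "Gamma (1 + s / 2) \<noteq> 0"
  proof
    assume "Gamma (1 + s / 2) = 0"
    then obtain n where "1 + s / 2 = of_int n" "n \<le> 0"
      by (auto simp: Gamma_eq_zero_iff elim!: nonpos_Ints_cases)
    then have "Re (1 + s / 2) \<le> 0" by simp
    then show False using assms by simp
  qed
  then have 1: "Gamma (1 + s / 2) * rGamma (1 + s / 2) = 1"
    by (simp add: rGamma_inverse_Gamma)
  have 2: "complex_of_real pi powr (- s / 2) * of_real pi powr (s / 2) = 1"
    by (simp add: powr_minus)
  have "(s - 1) * p * g * (p' * g' * x / (s - 1)) = x" if "p * p' = 1" "g * g' = 1" for p p' g g' x
  proof -
    have "(s - 1) * p * g * (p' * g' * x / (s - 1)) = (p * p') * (g * g') * x"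
      using s by simp
    then show ?thesis using that by simp
  qed
  from this[OF 2 1] show ?thesis
    unfolding riemann_xi_def zeta_eq_zeta_continuation[OF s] zeta_continuation_def .
qed

section \<open>Integration by parts against derivatives of \<open>psi\<close>\<close>

definition psi_power_integral :: "nat \<Rightarrow> complex \<Rightarrow> complex" where
  "psi_power_integral k z = (LBINT t:{1..}. complex_of_real t powr z * of_real (psi_deriv k t))"

lemma abs_psi_deriv_le:
  assumes "t \<ge> 1"
  shows "\<bar>psi_deriv k t\<bar> \<le> (\<Sum>n. freq n ^ k * exp (- (1 / 2 * freq n))) * exp (- t / 2)"
proof -
  have t: "t > 0" using assms by simp
  have summ: "summable (\<lambda>n. freq n ^ k * exp (- (1 / 2 * freq n)) * exp (- t / 2))"
    by (intro summable_mult2 summable_freq_power_exp) simp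
  have "\<bar>psi_deriv k t\<bar> \<le> (\<Sum>n. \<bar>(- freq n) ^ k * exp (- freq n * t)\<bar>)"
    unfolding psi_deriv_def by (rule summable_rabs[OF summable_psi_deriv[OF t]])
  also have "\<dots> \<le> (\<Sum>n. freq n ^ k * exp (- (1 / 2 * freq n)) * exp (- t / 2))"
  proof (rule suminf_le[OF _ summable_psi_deriv[OF t] summ])
    fix n
    have "freq n * 1 \<le> freq n * t" "1 * t \<le> freq n * t"
      using assms freq_ge_1[of n] by (auto intro: mult_right_mono)
    then have "exp (- freq n * t) \<le> exp (- (1 / 2 * freq n)) * exp (- t / 2)"
      by (simp flip: exp_add)
    then show "\<bar>(- freq n) ^ k * exp (- freq n * t)\<bar> \<le> freq n ^ k * exp (- (1 / 2 * freq n)) * exp (- t / 2)"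
      using freq_pos[of n] by (simp add: abs_mult power_abs mult.assoc mult_left_mono)
  qed
  also have "\<dots> = (\<Sum>n. freq n ^ k * exp (- (1 / 2 * freq n))) * exp (- t / 2)"
    by (intro suminf_mult2[symmetric] summable_freq_power_exp) simp
  finally show ?thesis .
qed

lemma powr_psi_deriv_tendsto_0: "((\<lambda>t. complex_of_real t powr z * of_real (psi_deriv k t)) \<longlongrightarrow> 0) at_top"
proof (rule Lim_null_comparison)
  define C where "C = (\<Sum>n. freq n ^ k * exp (- (1 / 2 * freq n)))"
  define a where "a = Re z"
  have "((\<lambda>t::real. t powr a * exp (- t / 2)) \<longlongrightarrow> 0) at_top" by real_asymp
  from tendsto_mult_right_zero[OF this, of C]
  show "((\<lambda>t. C * (t powr a * exp (- t / 2))) \<longlongrightarrow> 0) at_top" .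
  show "\<forall>\<^sub>F t in at_top. norm (complex_of_real t powr z * of_real (psi_deriv k t)) \<le> C * (t powr a * exp (- t / 2))"
    using eventually_ge_at_top[of 1]
  proof eventually_elim
    case (elim t)
    have "t powr a * \<bar>psi_deriv k t\<bar> \<le> t powr a * (C * exp (- t / 2))"
      using abs_psi_deriv_le[OF elim, of k] by (intro mult_left_mono) (simp_all add: C_def)
    then show ?case using elim by (simp add: norm_mult norm_powr_real_powr a_def mult_ac)
  qed
qed

lemma has_vector_derivative_powr_psi_deriv:
  assumes "t > 0"
  shows "((\<lambda>t. complex_of_real t powr z * of_real (psi_deriv k t)) has_vector_derivative
    z * (of_real t powr (z - 1) * of_real (psi_deriv k t)) + of_real t powr z * of_real (psi_deriv (Suc k) t)) (at t)"
proof -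
  have "((\<lambda>t. complex_of_real (psi_deriv k t)) has_vector_derivative of_real (psi_deriv (Suc k) t)) (at t)"
    using has_real_derivative_psi_deriv[OF assms] by (rule has_vector_derivative_of_real)
  from has_vector_derivative_mult[OF has_vector_derivative_of_real_powr[OF assms] this] show ?thesis
    by (simp add: algebra_simps)
qed

lemma set_integrable_powr_psi_deriv:
  "set_integrable lborel {1..} (\<lambda>t. complex_of_real t powr z * of_real (psi_deriv k t))"
  by (rule set_integrable_psi_deriv[OF set_integrable_powr_exp_half])

lemma psi_power_integral_Suc:
  "psi_power_integral (Suc k) z = - of_real (psi_deriv k 1) - z * psi_power_integral k (z - 1)"
proof -
  have "(LBINT t:{1..}. z * (of_real t powr (z - 1) * of_real (psi_deriv k t)) + of_real t powr z * of_real (psi_deriv (Suc k) t)) =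
    0 - complex_of_real 1 powr z * of_real (psi_deriv k 1)"
    by (rule set_integral_FTC_atLeast[OF has_vector_derivative_powr_psi_deriv _ _ powr_psi_deriv_tendsto_0])
       (intro continuous_intros continuous_on_of_real_powr continuous_on_psi_deriv
         set_integral_add(1) set_integrable_mult_right set_integrable_powr_psi_deriv | assumption)+
  also have "(LBINT t:{1..}. z * (of_real t powr (z - 1) * of_real (psi_deriv k t)) + of_real t powr z * of_real (psi_deriv (Suc k) t)) =
    z * psi_power_integral k (z - 1) + psi_power_integral (Suc k) z"
    unfolding psi_power_integral_def
    by (subst set_integral_add(2)) (auto intro: set_integrable_powr_psi_deriv)
  finally show ?thesis by (simp add: algebra_simps)
qed

text \<open>The weights 4 and 6 are 4 times those in t psi'' + (3/2) psi'. The first integration by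
  parts merges both terms into one integral with coefficient -(2 + 4z), the second reduces it to
  \<open>psi\<close>. At z = -3/4 + i tau/2 the product (2 + 4z)(z + 1) is -(tau^2 + 1/4).\<close>

lemma psi_power_integral_by_parts:
  "4 * psi_power_integral 2 (z + 2) + 6 * psi_power_integral 1 (z + 1) =
     (2 + 4 * z) * (z + 1) * psi_power_integral 0 z - 4 * of_real (psi_deriv 1 1) + (2 + 4 * z) * of_real (psi 1)"
proof -
  have 2: "psi_power_integral 2 (z + 2) = - of_real (psi_deriv 1 1) - (z + 2) * psi_power_integral 1 (z + 1)"
    using psi_power_integral_Suc[of 1 "z + 2"] by (simp add: numeral_2_eq_2 algebra_simps)
  have 1: "psi_power_integral 1 (z + 1) = - of_real (psi 1) - (z + 1) * psi_power_integral 0 z"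
    using psi_power_integral_Suc[of 0 "z + 1"] by (simp add: psi_eq_psi_deriv)
  show ?thesis unfolding 2 unfolding 1 by (simp add: algebra_simps)
qed

section \<open>The cosine weight and the two integral formulas\<close>

text \<open>The common weight of all the formulas: p = -3/4 goes with \<open>psi\<close>, 1/4 with
  its first and 5/4 with its second derivative.\<close>

definition cos_kernel :: "real \<Rightarrow> complex \<Rightarrow> real \<Rightarrow> complex" where
  "cos_kernel p \<tau> t = of_real (t powr p) * cos (\<tau> / 2 * of_real (ln t))"

lemma cos_kernel_eq:
  assumes "t > 0"
  shows "cos_kernel p \<tau> t =
    1 / 2 * (complex_of_real t powr (of_real p + \<i> * \<tau> / 2) + complex_of_real t powr (of_real p - \<i> * \<tau> / 2))"
proof -
  have 1: "complex_of_real t powr (of_real p + w) = of_real (t powr p) * exp (w * of_real (ln t))" for w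
    using assms by (simp add: powr_def Ln_of_real exp_add distrib_right exp_of_real[symmetric])
  show ?thesis
    using 1[of "\<i> * \<tau> / 2"] 1[of "- (\<i> * \<tau> / 2)"]
    by (simp add: cos_kernel_def cos_exp_eq algebra_simps)
qed

lemma cos_kernel_powr_mult: "t > 0 \<Longrightarrow> of_real t * cos_kernel p \<tau> t = cos_kernel (p + 1) \<tau> t"
  by (simp add: cos_kernel_def powr_add)

lemma set_integrable_cos_kernel_exp:
  "set_integrable lborel {1..} (\<lambda>t. cos_kernel p \<tau> t * of_real (exp (- t / 2)))"
proof -
  have "set_integrable lborel {1..} (\<lambda>t. 1 / 2 *
      (complex_of_real t powr (of_real p + \<i> * \<tau> / 2) * of_real (exp (- t / 2)) +
       complex_of_real t powr (of_real p - \<i> * \<tau> / 2) * of_real (exp (- t / 2))))"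
    by (intro set_integrable_mult_right set_integral_add(1) set_integrable_powr_exp_half)
  also have "?this \<longleftrightarrow> ?thesis"
    by (rule set_integrable_cong) (auto simp: cos_kernel_eq distrib_right)
  finally show ?thesis .
qed

lemmas set_integrable_cos_kernel_freq = set_integrable_freq[OF set_integrable_cos_kernel_exp]
lemmas set_integrable_cos_kernel_psi = set_integrable_psi_deriv[OF set_integrable_cos_kernel_exp]
lemmas sums_cos_kernel_psi = sums_set_integral_psi_deriv[OF set_integrable_cos_kernel_exp]

lemma set_integral_cos_kernel_psi:
  "(LBINT t:{1..}. cos_kernel p \<tau> t * of_real (psi_deriv k t)) =
    1 / 2 * (psi_power_integral k (of_real p + \<i> * \<tau> / 2) + psi_power_integral k (of_real p - \<i> * \<tau> / 2))"
proof -
  have "(LBINT t:{1..}. cos_kernel p \<tau> t * of_real (psi_deriv k t)) =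
    (LBINT t:{1..}. 1 / 2 * (complex_of_real t powr (of_real p + \<i> * \<tau> / 2) * of_real (psi_deriv k t) +
      complex_of_real t powr (of_real p - \<i> * \<tau> / 2) * of_real (psi_deriv k t)))"
    by (rule set_lebesgue_integral_cong) (auto simp: cos_kernel_eq distrib_right)
  also have "\<dots> = 1 / 2 * (psi_power_integral k (of_real p + \<i> * \<tau> / 2) + psi_power_integral k (of_real p - \<i> * \<tau> / 2))"
    unfolding psi_power_integral_def
    by (subst set_integral_mult_right, subst set_integral_add(2)) (auto intro: set_integrable_powr_psi_deriv)
  finally show ?thesis .
qed

text \<open>At s = 1/2 + i tau the condition on Im tau is 0 < Re s < 1, the two half integrals have
  exponents -3/4 + i tau/2 and -3/4 - i tau/2, and s (s - 1) = -(tau^2 + 1/4).\<close>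

lemma riemann_Xi_eq_psi_integral:
  assumes "\<bar>Im \<tau>\<bar> < 1 / 2"
  shows "riemann_Xi \<tau> = 1 / 2 - (\<tau>\<^sup>2 + 1 / 4) * (LBINT t:{1..}. cos_kernel (- 3 / 4) \<tau> t * of_real (psi_deriv 0 t))"
proof -
  define s where "s = 1 / 2 + \<i> * \<tau>"
  have s: "0 < Re s" "Re s < 1" using assms by (auto simp: s_def)
  have mellin: "half_mellin z = psi_power_integral 0 (z / 2 - 1)" for z
    by (simp add: half_mellin_def psi_power_integral_def psi_eq_psi_deriv)
  have e: "s / 2 - 1 = of_real (- 3 / 4) + \<i> * \<tau> / 2" "(1 - s) / 2 - 1 = of_real (- 3 / 4) - \<i> * \<tau> / 2"
    by (simp_all add: s_def field_simps)
  have ss: "s * (s - 1) = - (\<tau>\<^sup>2 + 1 / 4)"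
    by (simp add: s_def algebra_simps power2_eq_square)
  have alg: "1 / 2 + - u / 2 * (a + b) = 1 / 2 - u * (1 / 2 * (a + b))" for u a b :: complex
    by simp
  show ?thesis
    unfolding set_integral_cos_kernel_psi riemann_Xi_def s_def[symmetric] riemann_xi_eq[OF s] mellin e ss
    by (rule alg)
qed

lemma riemann_Xi_eq_psi_deriv_integrals:
  assumes "\<bar>Im \<tau>\<bar> < 1 / 2"
  shows "riemann_Xi \<tau> = 4 * ((LBINT t:{1..}. cos_kernel (5 / 4) \<tau> t * of_real (psi_deriv 2 t)) +
    3 / 2 * (LBINT t:{1..}. cos_kernel (1 / 4) \<tau> t * of_real (psi_deriv 1 t)))"
proof -
  define z where "z \<sigma> = of_real (- 3 / 4) + \<i> * \<sigma> / 2" for \<sigma> :: complex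
  have e: "of_real (5 / 4) + \<i> * \<sigma> / 2 = z \<sigma> + 2" "of_real (1 / 4) + \<i> * \<sigma> / 2 = z \<sigma> + 1" for \<sigma> :: complex
    by (simp_all add: z_def)
  have minus: "of_real p - \<i> * \<sigma> / 2 = of_real p + \<i> * (- \<sigma>) / 2" for p :: real and \<sigma> :: complex by simp
  have c: "(2 + 4 * z \<sigma>) * (z \<sigma> + 1) = - (\<sigma>\<^sup>2 + 1 / 4)" for \<sigma>
    by (simp add: z_def field_simps power2_eq_square)
  have c': "2 + 4 * z \<sigma> = 2 * \<i> * \<sigma> - 1" for \<sigma>
    by (simp add: z_def field_simps)
  have parts: "4 * psi_power_integral 2 (z \<sigma> + 2) + 6 * psi_power_integral 1 (z \<sigma> + 1) =
      - (\<sigma>\<^sup>2 + 1 / 4) * psi_power_integral 0 (z \<sigma>) - 4 * of_real (psi_deriv 1 1) + (2 * \<i> * \<sigma> - 1) * of_real (psi 1)" for \<sigma>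
    using psi_power_integral_by_parts[of "z \<sigma>"] unfolding c unfolding c' .
  have "4 * psi_deriv 1 1 = - psi 1 - 1 / 2"
    using psi_deriv_at_1 by (simp add: field_simps)
  then have "complex_of_real (4 * psi_deriv 1 1) = of_real (- psi 1 - 1 / 2)"
    by (simp only:)
  then have b: "4 * of_real (psi_deriv 1 1) = - of_real (psi 1) - (1 / 2 :: complex)"
    by (simp only: of_real_mult of_real_diff of_real_minus of_real_numeral of_real_divide of_real_1)
  have "4 * ((LBINT t:{1..}. cos_kernel (5 / 4) \<tau> t * of_real (psi_deriv 2 t)) +
    3 / 2 * (LBINT t:{1..}. cos_kernel (1 / 4) \<tau> t * of_real (psi_deriv 1 t))) =
    1 / 2 * ((4 * psi_power_integral 2 (z \<tau> + 2) + 6 * psi_power_integral 1 (z \<tau> + 1)) +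
      (4 * psi_power_integral 2 (z (- \<tau>) + 2) + 6 * psi_power_integral 1 (z (- \<tau>) + 1)))"
    unfolding set_integral_cos_kernel_psi minus e by (simp add: algebra_simps)
  \<comment> \<open>The boundary terms odd in tau cancel in the mean; what is left, -4 psi'(1) -
    psi(1), equals 1/2.\<close>
  also have "\<dots> = 1 / 2 - (\<tau>\<^sup>2 + 1 / 4) * (1 / 2 * (psi_power_integral 0 (z \<tau>) + psi_power_integral 0 (z (- \<tau>))))"
    unfolding parts b by (simp add: algebra_simps)
  also have "\<dots> = riemann_Xi \<tau>"
    unfolding riemann_Xi_eq_psi_integral[OF assms] set_integral_cos_kernel_psi minus z_def ..
  finally show ?thesis ..
qed

section \<open>The termwise form of the derivative formula\<close>

text \<open>The n-th term of t psi'' + (3/2) psi' has the coefficient pi^2 n^4 t - (3/2) pi n^2.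
  Dividing by pi^2 explains both the 3/(2 pi) and the outer factor pi^2 of the first
  formula.\<close>

lemma xi_series_term:
  assumes "t > 0"
  shows "of_real (t powr (1 / 4)) * cos (\<tau> * of_real (ln (sqrt t))) *
          of_real (((real (Suc n)) ^ 4 * t - 3 / (2 * pi) * (real (Suc n))\<^sup>2) *
                   exp (- (real (Suc n))\<^sup>2 * pi * t)) =
    1 / (of_real pi)\<^sup>2 * (cos_kernel (5 / 4) \<tau> t * of_real ((- freq n) ^ 2 * exp (- freq n * t)) +
      3 / 2 * (cos_kernel (1 / 4) \<tau> t * of_real ((- freq n) ^ 1 * exp (- freq n * t))))"
proof -
  define N where "N = (real (Suc n))\<^sup>2"
  define c where "c = cos_kernel (1 / 4) \<tau> t"
  have N4: "(real (Suc n)) ^ 4 = N\<^sup>2" by (simp add: N_def flip: power_mult)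
  have freq: "freq n = pi * N" by (simp add: freq_def N_def)
  have c: "of_real (t powr (1 / 4)) * cos (\<tau> * of_real (ln (sqrt t))) = c"
    using assms by (simp add: c_def cos_kernel_def ln_sqrt)
  have c': "cos_kernel (5 / 4) \<tau> t = of_real t * c"
    using cos_kernel_powr_mult[OF assms, of "1 / 4" \<tau>] by (simp add: c_def)
  have "(N\<^sup>2 * t - 3 / (2 * pi) * N) * exp (- N * pi * t) =
      1 / pi\<^sup>2 * (t * ((- freq n) ^ 2 * exp (- freq n * t)) + 3 / 2 * ((- freq n) ^ 1 * exp (- freq n * t)))"
    unfolding freq by (simp add: field_simps power2_eq_square)
  then have "of_real ((N\<^sup>2 * t - 3 / (2 * pi) * N) * exp (- N * pi * t)) =
      1 / (complex_of_real pi)\<^sup>2 * (of_real t * of_real ((- freq n) ^ 2 * exp (- freq n * t)) +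
        3 / 2 * of_real ((- freq n) ^ 1 * exp (- freq n * t)))"
    by (simp only: of_real_mult of_real_add of_real_divide of_real_power of_real_1 of_real_numeral)
  then show ?thesis
    unfolding c N4 N_def[symmetric] c_def[symmetric] c' by (simp only:) (simp only: ring_distribs mult_ac)
qed

lemma xi_series_integrals:
  fixes \<tau> :: complex
  defines "f \<equiv> \<lambda>n t. of_real (t powr (1 / 4)) * cos (\<tau> * of_real (ln (sqrt t))) *
          of_real (((real (Suc n)) ^ 4 * t - 3 / (2 * pi) * (real (Suc n))\<^sup>2) *
                   exp (- (real (Suc n))\<^sup>2 * pi * t))"
  shows "set_integrable lborel {1..} (f n)"
    and "(\<lambda>n. LBINT t:{1..}. f n t) sums
      (1 / (of_real pi)\<^sup>2 * ((LBINT t:{1..}. cos_kernel (5 / 4) \<tau> t * of_real (psi_deriv 2 t)) +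
        3 / 2 * (LBINT t:{1..}. cos_kernel (1 / 4) \<tau> t * of_real (psi_deriv 1 t))))"
proof -
  define g where "g n t = cos_kernel (5 / 4) \<tau> t * of_real ((- freq n) ^ 2 * exp (- freq n * t))" for n t
  define h where "h n t = cos_kernel (1 / 4) \<tau> t * of_real ((- freq n) ^ 1 * exp (- freq n * t))" for n t
  have f_eq: "f n t = 1 / (of_real pi)\<^sup>2 * (g n t + 3 / 2 * h n t)" if "t \<in> {1..}" for n t
    using that unfolding f_def g_def h_def by (intro xi_series_term) simp
  have g: "set_integrable lborel {1..} (g n)" for n
    unfolding g_def by (rule set_integrable_cos_kernel_freq)
  have h: "set_integrable lborel {1..} (\<lambda>t. 3 / 2 * h n t)" for n
    unfolding h_def by (intro set_integrable_mult_right set_integrable_cos_kernel_freq)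
  have "set_integrable lborel {1..} (\<lambda>t. 1 / (of_real pi)\<^sup>2 * (g n t + 3 / 2 * h n t))"
    by (intro set_integrable_mult_right set_integral_add(1) g h)
  then show "set_integrable lborel {1..} (f n)"
    by (subst set_integrable_cong[OF refl refl f_eq]) simp_all
  have "(LBINT t:{1..}. f n t) = (LBINT t:{1..}. 1 / (of_real pi)\<^sup>2 * (g n t + 3 / 2 * h n t))" for n
    using f_eq by (intro set_lebesgue_integral_cong) auto
  also have "(LBINT t:{1..}. 1 / (of_real pi)\<^sup>2 * (g n t + 3 / 2 * h n t)) =
      1 / (of_real pi)\<^sup>2 * ((LBINT t:{1..}. g n t) + 3 / 2 * (LBINT t:{1..}. h n t))" for n
    unfolding set_integral_mult_right set_integral_add(2)[OF g h] ..
  finally have "(\<lambda>n. LBINT t:{1..}. f n t) =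
      (\<lambda>n. 1 / (of_real pi)\<^sup>2 * ((LBINT t:{1..}. g n t) + 3 / 2 * (LBINT t:{1..}. h n t)))"
    by (rule ext)
  moreover have "\<dots> sums (1 / (of_real pi)\<^sup>2 * ((LBINT t:{1..}. cos_kernel (5 / 4) \<tau> t * of_real (psi_deriv 2 t)) +
        3 / 2 * (LBINT t:{1..}. cos_kernel (1 / 4) \<tau> t * of_real (psi_deriv 1 t))))"
    unfolding g_def h_def by (intro sums_mult sums_add sums_cos_kernel_psi)
  ultimately show "(\<lambda>n. LBINT t:{1..}. f n t) sums
      (1 / (of_real pi)\<^sup>2 * ((LBINT t:{1..}. cos_kernel (5 / 4) \<tau> t * of_real (psi_deriv 2 t)) +
        3 / 2 * (LBINT t:{1..}. cos_kernel (1 / 4) \<tau> t * of_real (psi_deriv 1 t))))"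
    by (simp only:)
qed

lemma xi_psi_deriv_integral:
  fixes \<tau> :: complex
  defines "f \<equiv> \<lambda>t. of_real (t powr (1 / 4)) * cos (1 / 2 * \<tau> * of_real (ln t)) *
          of_real (t * deriv (deriv psi) t + 3 / 2 * deriv psi t)"
  shows "set_integrable lborel {1..} f"
    and "(LBINT t:{1..}. f t) = (LBINT t:{1..}. cos_kernel (5 / 4) \<tau> t * of_real (psi_deriv 2 t)) +
        3 / 2 * (LBINT t:{1..}. cos_kernel (1 / 4) \<tau> t * of_real (psi_deriv 1 t))"
proof -
  have f_eq: "f t = cos_kernel (5 / 4) \<tau> t * of_real (psi_deriv 2 t) +
      3 / 2 * (cos_kernel (1 / 4) \<tau> t * of_real (psi_deriv 1 t))" if "t \<in> {1..}" for t
  proof -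
    have t: "t > 0" using that by simp
    have "cos_kernel (5 / 4) \<tau> t = of_real t * cos_kernel (1 / 4) \<tau> t"
      using cos_kernel_powr_mult[OF t, of "1 / 4" \<tau>] by simp
    moreover have "of_real (t powr (1 / 4)) * cos (1 / 2 * \<tau> * of_real (ln t)) = cos_kernel (1 / 4) \<tau> t"
      by (simp add: cos_kernel_def)
    ultimately show ?thesis
      unfolding f_def deriv_psi[OF t] deriv_deriv_psi[OF t] by (simp only:) (simp add: algebra_simps)
  qed
  note int = set_integrable_cos_kernel_psi[of "5 / 4" \<tau> 2]
    set_integrable_mult_right[OF set_integrable_cos_kernel_psi[of "1 / 4" \<tau> 1], of "3 / 2"]
  show "set_integrable lborel {1..} f"
    by (subst set_integrable_cong[OF refl refl f_eq]) (assumption | rule set_integral_add(1)[OF int])+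
  have "(LBINT t:{1..}. f t) = (LBINT t:{1..}. cos_kernel (5 / 4) \<tau> t * of_real (psi_deriv 2 t) +
      3 / 2 * (cos_kernel (1 / 4) \<tau> t * of_real (psi_deriv 1 t)))"
    using f_eq by (intro set_lebesgue_integral_cong) auto
  then show "(LBINT t:{1..}. f t) = (LBINT t:{1..}. cos_kernel (5 / 4) \<tau> t * of_real (psi_deriv 2 t)) +
        3 / 2 * (LBINT t:{1..}. cos_kernel (1 / 4) \<tau> t * of_real (psi_deriv 1 t))"
    unfolding set_integral_add(2)[OF int] by simp
qed

section \<open>Exponential integrals and the final statement\<close>

text \<open>The trivial power with exponent 0 brings the integrand into the shape of the termwise
  integration results at k = 0.\<close>

lemma exp_integral_integrand_eq:
  "of_real t powr (- z) * exp (- of_real (pi * (real (Suc n))\<^sup>2) * of_real t) =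
    complex_of_real t powr (- z) * of_real ((- freq n) ^ 0 * exp (- freq n * t))"
  by (simp add: freq_def exp_of_real[symmetric])

lemma set_integrable_exp_integral:
  "set_integrable lborel {1..} (\<lambda>t. complex_of_real t powr (- z) * exp (- of_real (pi * (real (Suc n))\<^sup>2) * of_real t))"
  unfolding exp_integral_integrand_eq by (rule set_integrable_freq[OF set_integrable_powr_exp_half])

text \<open>As t and the frequency are real, conjugating the integral conjugates only its exponent:
  3/4 + i cnj(tau)/2 becomes 3/4 - i tau/2. The two powers then average to the cosine.\<close>

lemma continued_Re_exp_integral:
  "continued_Re (\<lambda>\<sigma>. exp_integral (3 / 4 + \<i> * \<sigma> / 2) (of_real (pi * (real (Suc n))\<^sup>2))) \<tau> =
    (LBINT t:{1..}. cos_kernel (- 3 / 4) \<tau> t * of_real ((- freq n) ^ 0 * exp (- freq n * t)))"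
proof -
  define f where "f z t = complex_of_real t powr (- z) * of_real ((- freq n) ^ 0 * exp (- freq n * t))" for z t
  have f: "set_integrable lborel {1..} (f z)" for z
    unfolding f_def by (rule set_integrable_freq[OF set_integrable_powr_exp_half])
  have E: "exp_integral z (of_real (pi * (real (Suc n))\<^sup>2)) = (LBINT t:{1..}. f z t)" for z
    unfolding exp_integral_def exp_integral_integrand_eq f_def ..
  have "cnj (LBINT t:{1..}. f z t) = (LBINT t:{1..}. cnj (f z t))" for z
    unfolding set_lebesgue_integral_def by (subst Bochner_Integration.integral_cnj[symmetric]) simp
  also have "(LBINT t:{1..}. cnj (f z t)) = (LBINT t:{1..}. f (cnj z) t)" for z
    by (rule set_lebesgue_integral_cong) (auto simp: f_def cnj_powr)
  finally have cnj: "cnj (LBINT t:{1..}. f z t) = (LBINT t:{1..}. f (cnj z) t)" for z .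
  have "continued_Re (\<lambda>\<sigma>. exp_integral (3 / 4 + \<i> * \<sigma> / 2) (of_real (pi * (real (Suc n))\<^sup>2))) \<tau> =
      1 / 2 * ((LBINT t:{1..}. f (3 / 4 + \<i> * \<tau> / 2) t) + (LBINT t:{1..}. f (3 / 4 - \<i> * \<tau> / 2) t))"
    unfolding continued_Re_def E cnj by simp
  also have "\<dots> = (LBINT t:{1..}. 1 / 2 * (f (3 / 4 + \<i> * \<tau> / 2) t + f (3 / 4 - \<i> * \<tau> / 2) t))"
    unfolding set_integral_mult_right set_integral_add(2)[OF f f] ..
  also have "\<dots> = (LBINT t:{1..}. cos_kernel (- 3 / 4) \<tau> t * of_real ((- freq n) ^ 0 * exp (- freq n * t)))"
  proof (intro set_lebesgue_integral_cong allI impI)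
    fix t :: real assume "t \<in> {1..}"
    then have t: "t > 0" by simp
    have e: "- (3 / 4 + \<i> * \<tau> / 2) = complex_of_real (- 3 / 4) - \<i> * \<tau> / 2"
      "- (3 / 4 - \<i> * \<tau> / 2) = complex_of_real (- 3 / 4) + \<i> * \<tau> / 2" by simp_all
    show "1 / 2 * (f (3 / 4 + \<i> * \<tau> / 2) t + f (3 / 4 - \<i> * \<tau> / 2) t) =
        cos_kernel (- 3 / 4) \<tau> t * of_real ((- freq n) ^ 0 * exp (- freq n * t))"
      unfolding f_def cos_kernel_eq[OF t] e by (simp only: ring_distribs mult_ac add_ac)
  qed simp
  finally show ?thesis .
qed

lemma sums_continued_Re_exp_integral:
  "(\<lambda>n. continued_Re (\<lambda>\<sigma>. exp_integral (3 / 4 + \<i> * \<sigma> / 2) (of_real (pi * (real (Suc n))\<^sup>2))) \<tau>) sums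
    (LBINT t:{1..}. cos_kernel (- 3 / 4) \<tau> t * of_real (psi_deriv 0 t))"
  unfolding continued_Re_exp_integral by (rule sums_cos_kernel_psi)

theorem corollary2:
  fixes \<tau> :: complex
  assumes "\<bar>Im \<tau>\<bar> < 1 / 2"
  shows
    "(\<forall>n. set_integrable lborel {1..} (\<lambda>t. of_real (t powr (1 / 4)) * cos (\<tau> * of_real (ln (sqrt t))) *
          of_real (((real (Suc n)) ^ 4 * t - 3 / (2 * pi) * (real (Suc n))\<^sup>2) *
                   exp (- (real (Suc n))\<^sup>2 * pi * t)))) \<and>
     summable (\<lambda>n. LBINT t:{1..}. of_real (t powr (1 / 4)) * cos (\<tau> * of_real (ln (sqrt t))) *
          of_real (((real (Suc n)) ^ 4 * t - 3 / (2 * pi) * (real (Suc n))\<^sup>2) *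
                   exp (- (real (Suc n))\<^sup>2 * pi * t))) \<and>
     riemann_Xi \<tau> = 4 * (of_real pi)\<^sup>2 *
       (\<Sum>n. LBINT t:{1..}. of_real (t powr (1 / 4)) * cos (\<tau> * of_real (ln (sqrt t))) *
          of_real (((real (Suc n)) ^ 4 * t - 3 / (2 * pi) * (real (Suc n))\<^sup>2) *
                   exp (- (real (Suc n))\<^sup>2 * pi * t))) \<and>
     set_integrable lborel {1..} (\<lambda>t. of_real (t powr (1 / 4)) * cos (1 / 2 * \<tau> * of_real (ln t)) *
          of_real (t * deriv (deriv psi) t + 3 / 2 * deriv psi t)) \<and>
     riemann_Xi \<tau> = 4 *
       (LBINT t:{1..}. of_real (t powr (1 / 4)) * cos (1 / 2 * \<tau> * of_real (ln t)) *
          of_real (t * deriv (deriv psi) t + 3 / 2 * deriv psi t)) \<and>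
     (\<forall>n. \<forall>\<sigma>\<in>{\<tau>, cnj \<tau>}. set_integrable lborel {1..} (\<lambda>t. of_real t powr (- (3 / 4 + \<i> * \<sigma> / 2)) *
          exp (- of_real (pi * (real (Suc n))\<^sup>2) * of_real t))) \<and>
     summable (\<lambda>n. continued_Re
          (\<lambda>\<sigma>. exp_integral (3 / 4 + \<i> * \<sigma> / 2) (of_real (pi * (real (Suc n))\<^sup>2))) \<tau>) \<and>
     riemann_Xi \<tau> = 1 / 2 - (\<tau>\<^sup>2 + 1 / 4) *
       (\<Sum>n. continued_Re
          (\<lambda>\<sigma>. exp_integral (3 / 4 + \<i> * \<sigma> / 2) (of_real (pi * (real (Suc n))\<^sup>2))) \<tau>) \<and>
     (\<tau> \<in> \<real> \<longrightarrow>
       riemann_Xi \<tau> = 1 / 2 - (\<tau>\<^sup>2 + 1 / 4) *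
         of_real (\<Sum>n. Re (exp_integral (3 / 4 + \<i> * \<tau> / 2) (of_real (pi * (real (Suc n))\<^sup>2))))) \<and>
     set_integrable lborel {1..} (\<lambda>t. of_real (1 / t powr (3 / 4)) * cos (\<tau> / 2 * of_real (ln t)) *
          of_real (psi t)) \<and>
     riemann_Xi \<tau> = 1 / 2 - (\<tau>\<^sup>2 + 1 / 4) *
       (LBINT t:{1..}. of_real (1 / t powr (3 / 4)) * cos (\<tau> / 2 * of_real (ln t)) * of_real (psi t))"
proof (intro conjI allI ballI impI)
  note Xi = riemann_Xi_eq_psi_integral[OF assms]
  note Xi' = riemann_Xi_eq_psi_deriv_integrals[OF assms]
  note series = xi_series_integrals[of \<tau>]
  note sums = sums_continued_Re_exp_integral[of \<tau>]
  let ?f = "\<lambda>n t. of_real (t powr (1 / 4)) * cos (\<tau> * of_real (ln (sqrt t))) *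
          of_real (((real (Suc n)) ^ 4 * t - 3 / (2 * pi) * (real (Suc n))\<^sup>2) *
                   exp (- (real (Suc n))\<^sup>2 * pi * t))"
  let ?E = "\<lambda>\<sigma> n. exp_integral (3 / 4 + \<i> * \<sigma> / 2) (of_real (pi * (real (Suc n))\<^sup>2))"
  have last: "of_real (1 / t powr (3 / 4)) * cos (\<tau> / 2 * of_real (ln t)) * of_real (psi t) =
      cos_kernel (- 3 / 4) \<tau> t * of_real (psi_deriv 0 t)" for t
    by (simp add: cos_kernel_def psi_eq_psi_deriv powr_minus_divide)
  show "set_integrable lborel {1..} (?f n)" for n
    by (rule series(1))
  show "summable (\<lambda>n. LBINT t:{1..}. ?f n t)"
    using series(2) by (rule sums_summable)
  show "riemann_Xi \<tau> = 4 * (of_real pi)\<^sup>2 * (\<Sum>n. LBINT t:{1..}. ?f n t)"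
    unfolding sums_unique[OF series(2), symmetric] Xi' by simp
  show "set_integrable lborel {1..} (\<lambda>t. of_real (t powr (1 / 4)) * cos (1 / 2 * \<tau> * of_real (ln t)) *
          of_real (t * deriv (deriv psi) t + 3 / 2 * deriv psi t))"
    by (rule xi_psi_deriv_integral)
  show "riemann_Xi \<tau> = 4 *
       (LBINT t:{1..}. of_real (t powr (1 / 4)) * cos (1 / 2 * \<tau> * of_real (ln t)) *
          of_real (t * deriv (deriv psi) t + 3 / 2 * deriv psi t))"
    unfolding xi_psi_deriv_integral(2) by (rule Xi')
  show "set_integrable lborel {1..} (\<lambda>t. of_real t powr (- (3 / 4 + \<i> * \<sigma> / 2)) *
          exp (- of_real (pi * (real (Suc n))\<^sup>2) * of_real t))" for n \<sigma>
    by (rule set_integrable_exp_integral)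
  show "summable (\<lambda>n. continued_Re (\<lambda>\<sigma>. ?E \<sigma> n) \<tau>)"
    using sums by (rule sums_summable)
  show Xi_E: "riemann_Xi \<tau> = 1 / 2 - (\<tau>\<^sup>2 + 1 / 4) * (\<Sum>n. continued_Re (\<lambda>\<sigma>. ?E \<sigma> n) \<tau>)"
    unfolding sums_unique[OF sums, symmetric] by (rule Xi)
  show "riemann_Xi \<tau> = 1 / 2 - (\<tau>\<^sup>2 + 1 / 4) * of_real (\<Sum>n. Re (?E \<tau> n))" if "\<tau> \<in> \<real>"
  proof -
    obtain x where x: "\<tau> = of_real x" using \<open>\<tau> \<in> \<real>\<close> by (rule Reals_cases)
    have eq: "continued_Re (\<lambda>\<sigma>. ?E \<sigma> n) \<tau> = of_real (Re (?E \<tau> n))" for n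
      unfolding x by (rule continued_Re_of_real)
    \<comment> \<open>Moving \<open>of_real\<close> through the infinite sum requires convergence of
      the real series, which is inherited from the complex one.\<close>
    have "summable (\<lambda>n. complex_of_real (Re (?E \<tau> n)))"
      using sums_summable[OF sums] unfolding eq .
    then have "summable (\<lambda>n. Re (?E \<tau> n))"
      by (simp only: summable_of_real_iff)
    then have "of_real (\<Sum>n. Re (?E \<tau> n)) = (\<Sum>n. complex_of_real (Re (?E \<tau> n)))"
      by (rule suminf_of_real)
    then show ?thesis using Xi_E unfolding eq by (simp only:)
  qed
  show "set_integrable lborel {1..} (\<lambda>t. of_real (1 / t powr (3 / 4)) * cos (\<tau> / 2 * of_real (ln t)) *
          of_real (psi t))"
    unfolding last by (rule set_integrable_cos_kernel_psi)
  show "riemann_Xi \<tau> = 1 / 2 - (\<tau>\<^sup>2 + 1 / 4) *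
       (LBINT t:{1..}. of_real (1 / t powr (3 / 4)) * cos (\<tau> / 2 * of_real (ln t)) * of_real (psi t))"
    unfolding last by (rule Xi)
qed

end
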